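(* Let $(\omega_1,\omega_2,\omega_3)$ be an $\boldsymbol\varepsilon$-hypersymplectic structure on a Lie algebroid $(A,\rho,[\cdot,\cdot])$ such that $\varepsilon_1\varepsilon_2\varepsilon_3=1$, with transition tensors $N_i$ and induced $2$-form $g$. For all $i\in\{1,2,3\}$, the pairs $(\omega_i,N_i)$ and $(g,N_i)$ are $\Omega N$ structures on $A$.
   Context: Let $\mathrm d$ denote the differential of the Lie algebroid. For a $2$-form $\omega\in\Gamma(\bigwedge^2A^* )$, $\langle\omega^\flat(X),Y\rangle=\omega(X,Y)$; for a bivector $\pi\in\Gamma(\bigwedge^2A)$, $\langle\beta,\pi^\sharp(\alpha)\rangle=\pi(\alpha,\beta)$. A symplectic form is a closed non-degenerate $2$-form; its inverse Poisson bivector $\pi$ satisfies $\omega^\flat\circ\pi^\sharp=\mathrm{Id}_{A^*}$, $\pi^\sharp\circ\omega^\flat=\mathrm{Id}_A$. All indices are in $\mathbb{Z}_3=\{1,2,3\}$. Given symplectic forms $\omega_1,\omega_2,\omega_3$ with inverses $\pi_1,\pi_2,\pi_3$, the transition tensors are $N_i:=\pi_{i-1}^\sharp\circ\omega_{i+1}^\flat$. The triple is an $\boldsymbol\varepsilon$-hypersymplectic structure, $\boldsymbol\varepsilon=(\varepsilon_1,\varepsilon_2,\varepsilon_3)$ with $\varepsilon_i=\pm1$, if $N_i^2=\varepsilon_i\mathrm{Id}_A$ for $i=1,2,3$. The induced tensor $g\in\Gamma(\bigotimes^2A^* )$ is $g(X,Y)=\langle g^\flat X,Y\rangle$ with $g^\flat:=\varepsilon_3\varepsilon_2\,\omega_3^\flat\circ\pi_1^\sharp\circ\omega_2^\flat$;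 when $\varepsilon_1\varepsilon_2\varepsilon_3=1$, $g$ is a $2$-form. The Nijenhuis torsion of a bundle endomorphism $N$ of $A$ is $\mathcal TN(X,Y)=[NX,NY]-N([NX,Y]+[X,NY]-N[X,Y])$, and $N^*$ is its transpose. A pair $(\omega,N)$, with $\omega$ a $2$-form on $A$, is an $\Omega N$ structure if $\mathrm d\omega=0$, $\mathcal TN=0$, $\omega^\flat\circ N=N^*\circ\omega^\flat$ and $\mathrm d(\omega_N)=0$, where $\omega_N(X,Y)=\omega(NX,Y)$. *)

theory Defs
  imports "HOL-Analysis.Analysis" "HOL-Library.Numeral_Type"
begin

section \<open>Smooth maps and manifolds\<close>

text \<open>
  The model spaces R^n are finite-dimensional inner product spaces. The class
  \<^class>\<open>euclidean_space\<close> is not used because it excludes dimension 0, hence Lie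
  algebroids over a point (that is, Lie algebras) and bundles of rank 0.
\<close>

definition finite_dim_space :: "'e::real_vector itself \<Rightarrow> bool" where
  "finite_dim_space _ \<longleftrightarrow> (\<exists>B :: 'e set. finite B \<and> span B = UNIV)"

text \<open>
  In finite dimension a map is of class C^(k+1) on an open set iff it is differentiable there
  and all its directional derivatives are of class C^k.
\<close>

primrec Ck_on :: "nat \<Rightarrow> ('e::real_normed_vector \<Rightarrow> 'f::real_normed_vector) \<Rightarrow> 'e set \<Rightarrow> bool" where
  "Ck_on 0 f S \<longleftrightarrow> continuous_on S f"
| "Ck_on (Suc k) f S \<longleftrightarrow>
     (\<forall>x\<in>S. f differentiable (at x)) \<and>
     (\<forall>h. Ck_on k (\<lambda>x. frechet_derivative f (at x) h) S)"

definition smooth_on :: "('e::real_normed_vector \<Rightarrow> 'f::real_normed_vector) \<Rightarrow> 'e set \<Rightarrow> bool" where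
  "smooth_on f S \<longleftrightarrow> (\<forall>k. Ck_on k f S)"

text \<open>
  A chart is a pair of its domain and a map that is only relevant on that domain.
\<close>

record ('m, 'e) manifold_data =
  charts :: "('m set \<times> ('m \<Rightarrow> 'e)) set"

definition smooth_manifold ::
  "('m::{t2_space,second_countable_topology}, 'e::real_inner, 'z) manifold_data_scheme \<Rightarrow> bool" where
  "smooth_manifold M \<longleftrightarrow>
     finite_dim_space TYPE('e) \<and>
     (\<Union>(U, \<phi>)\<in>charts M. U) = UNIV \<and>
     (\<forall>(U, \<phi>)\<in>charts M.
        open U \<and> open (\<phi> ` U) \<and> homeomorphism U (\<phi> ` U) \<phi> (inv_into U \<phi>)) \<and>
     (\<forall>(U, \<phi>)\<in>charts M. \<forall>(V, \<psi>)\<in>charts M.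
        smooth_on (\<lambda>y. \<psi> (inv_into U \<phi> y)) (\<phi> ` (U \<inter> V)))"

definition smooth_map_on ::
  "('m, 'e::real_inner, 'z) manifold_data_scheme \<Rightarrow> 'm set \<Rightarrow>
   ('m \<Rightarrow> 'f::real_normed_vector) \<Rightarrow> bool" where
  "smooth_map_on M W f \<longleftrightarrow>
     (\<forall>(U, \<phi>)\<in>charts M. smooth_on (\<lambda>y. f (inv_into U \<phi> y)) (\<phi> ` (U \<inter> W)))"

definition smooth_functions ::
  "('m, 'e::real_inner, 'z) manifold_data_scheme \<Rightarrow> ('m \<Rightarrow> real) set" where
  "smooth_functions M = {f. smooth_map_on M UNIV f}"

text \<open>Tangent vectors at a point are derivations of the algebra of smooth functions there.\<close>

definition tangent_vector ::
  "('m, 'e::real_inner, 'z) manifold_data_scheme \<Rightarrow> 'm \<Rightarrow> (('m \<Rightarrow> real) \<Rightarrow> real) \<Rightarrow> bool" where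
  "tangent_vector M x D \<longleftrightarrow>
     (\<forall>f\<in>smooth_functions M. \<forall>h\<in>smooth_functions M.
        D (\<lambda>y. f y + h y) = D f + D h \<and>
        D (\<lambda>y. f y * h y) = f x * D h + h x * D f) \<and>
     (\<forall>c. \<forall>f\<in>smooth_functions M. D (\<lambda>y. c * f y) = c * D f)"


section \<open>Vector bundles\<close>

definition linear_on_set :: "'v::real_vector set \<Rightarrow> ('v \<Rightarrow> 'w::real_vector) \<Rightarrow> bool" where
  "linear_on_set S f \<longleftrightarrow>
     (\<forall>u\<in>S. \<forall>v\<in>S. f (u + v) = f u + f v) \<and> (\<forall>c. \<forall>v\<in>S. f (c *\<^sub>R v) = c *\<^sub>R f v)"

text \<open>
  The fibres of a vector bundle are realised as linear subspaces of one real vector space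
  \<open>'v\<close>. This is no restriction: any family of vector spaces lies in its direct sum, and \<open>'v\<close>
  carries no topology or other structure related to the bundle. The topology and the smooth
  structure of the total space are those determined by the local trivialisations
  \<open>(U, \<tau>)\<close>, where \<open>\<tau> x\<close> for \<open>x \<in> U\<close> is a linear isomorphism from the fibre at \<open>x\<close> to the
  typical fibre \<open>'k\<close>; values of \<open>\<tau> x\<close> off the fibre are irrelevant.
\<close>

record ('m, 'e, 'v, 'k) bundle_data = "('m, 'e) manifold_data" +
  fibre :: "'m \<Rightarrow> 'v set"
  trivs :: "('m set \<times> ('m \<Rightarrow> 'v \<Rightarrow> 'k)) set"

definition vector_bundle ::
  "('m::{t2_space,second_countable_topology}, 'e::real_inner, 'v::real_vector, 'k::real_inner, 'z)
   bundle_data_scheme \<Rightarrow> bool" where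
  "vector_bundle A \<longleftrightarrow>
     smooth_manifold A \<and> finite_dim_space TYPE('k) \<and>
     (\<forall>x. subspace (fibre A x)) \<and>
     (\<Union>(U, \<tau>)\<in>trivs A. U) = UNIV \<and>
     (\<forall>(U, \<tau>)\<in>trivs A. open U \<and>
        (\<forall>x\<in>U. linear_on_set (fibre A x) (\<tau> x) \<and> bij_betw (\<tau> x) (fibre A x) UNIV)) \<and>
     (\<forall>(U, \<tau>)\<in>trivs A. \<forall>(V, \<sigma>)\<in>trivs A. \<forall>a.
        smooth_map_on A (U \<inter> V) (\<lambda>x. \<sigma> x (inv_into (fibre A x) (\<tau> x) a)))"

text \<open>Smooth global sections of \<open>A\<close>.\<close>

definition sections ::
  "('m, 'e::real_inner, 'v::real_vector, 'k::real_inner, 'z) bundle_data_scheme \<Rightarrow>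
   ('m \<Rightarrow> 'v) set" where
  "sections A = {X. (\<forall>x. X x \<in> fibre A x) \<and>
     (\<forall>(U, \<tau>)\<in>trivs A. smooth_map_on A U (\<lambda>x. \<tau> x (X x)))}"

text \<open>
  A covector at \<open>x\<close> is a linear functional on the fibre at \<open>x\<close>, represented by the function
  on \<open>'v\<close> that vanishes off the fibre, so that equality of covectors is equality of functions.
\<close>

definition covec ::
  "('m, 'e, 'v, 'k, 'z) bundle_data_scheme \<Rightarrow> 'm \<Rightarrow> ('v \<Rightarrow> real) \<Rightarrow> 'v \<Rightarrow> real" where
  "covec A x \<alpha> = (\<lambda>v. if v \<in> fibre A x then \<alpha> v else 0)"

definition dual_fibre ::
  "('m, 'e, 'v::real_vector, 'k, 'z) bundle_data_scheme \<Rightarrow> 'm \<Rightarrow> ('v \<Rightarrow> real) set" where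
  "dual_fibre A x = {\<alpha>. linear_on_set (fibre A x) \<alpha> \<and> covec A x \<alpha> = \<alpha>}"

text \<open>
  Smoothness of tensors is smoothness of their components in every local trivialisation.
\<close>

definition two_form ::
  "('m, 'e::real_inner, 'v::real_vector, 'k::real_inner, 'z) bundle_data_scheme \<Rightarrow>
   ('m \<Rightarrow> 'v \<Rightarrow> 'v \<Rightarrow> real) \<Rightarrow> bool" where
  "two_form A \<omega> \<longleftrightarrow>
     (\<forall>x. \<forall>v\<in>fibre A x.
        linear_on_set (fibre A x) (\<omega> x v) \<and> linear_on_set (fibre A x) (\<lambda>u. \<omega> x u v) \<and>
        \<omega> x v v = 0) \<and>
     (\<forall>(U, \<tau>)\<in>trivs A. \<forall>a b. smooth_map_on A U
        (\<lambda>x. \<omega> x (inv_into (fibre A x) (\<tau> x) a) (inv_into (fibre A x) (\<tau> x) b)))"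

definition bivector ::
  "('m, 'e::real_inner, 'v::real_vector, 'k::real_inner, 'z) bundle_data_scheme \<Rightarrow>
   ('m \<Rightarrow> ('v \<Rightarrow> real) \<Rightarrow> ('v \<Rightarrow> real) \<Rightarrow> real) \<Rightarrow> bool" where
  "bivector A \<pi> \<longleftrightarrow>
     (\<forall>x. \<forall>\<alpha>\<in>dual_fibre A x. \<forall>\<beta>\<in>dual_fibre A x. \<forall>\<gamma>\<in>dual_fibre A x.
        \<pi> x (\<lambda>v. \<alpha> v + \<beta> v) \<gamma> = \<pi> x \<alpha> \<gamma> + \<pi> x \<beta> \<gamma> \<and>
        \<pi> x \<gamma> (\<lambda>v. \<alpha> v + \<beta> v) = \<pi> x \<gamma> \<alpha> + \<pi> x \<gamma> \<beta>) \<and>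
     (\<forall>x c. \<forall>\<alpha>\<in>dual_fibre A x. \<forall>\<gamma>\<in>dual_fibre A x.
        \<pi> x (\<lambda>v. c * \<alpha> v) \<gamma> = c * \<pi> x \<alpha> \<gamma> \<and>
        \<pi> x \<gamma> (\<lambda>v. c * \<alpha> v) = c * \<pi> x \<gamma> \<alpha>) \<and>
     (\<forall>x. \<forall>\<alpha>\<in>dual_fibre A x. \<pi> x \<alpha> \<alpha> = 0) \<and>
     (\<forall>(U, \<tau>)\<in>trivs A. \<forall>a b. linear a \<longrightarrow> linear b \<longrightarrow> smooth_map_on A U
        (\<lambda>x. \<pi> x (covec A x (\<lambda>v. a (\<tau> x v))) (covec A x (\<lambda>v. b (\<tau> x v)))))"

definition bundle_endo ::
  "('m, 'e::real_inner, 'v::real_vector, 'k::real_inner, 'z) bundle_data_scheme \<Rightarrow>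
   ('m \<Rightarrow> 'v \<Rightarrow> 'v) \<Rightarrow> bool" where
  "bundle_endo A N \<longleftrightarrow>
     (\<forall>x. N x ` fibre A x \<subseteq> fibre A x \<and> linear_on_set (fibre A x) (N x)) \<and>
     (\<forall>(U, \<tau>)\<in>trivs A. \<forall>a. smooth_map_on A U
        (\<lambda>x. \<tau> x (N x (inv_into (fibre A x) (\<tau> x) a))))"

definition flat ::
  "('m, 'e, 'v, 'k, 'z) bundle_data_scheme \<Rightarrow>
   ('m \<Rightarrow> 'v \<Rightarrow> 'v \<Rightarrow> real) \<Rightarrow> 'm \<Rightarrow> 'v \<Rightarrow> 'v \<Rightarrow> real" where
  "flat A \<omega> x v = covec A x (\<omega> x v)"

text \<open>
  \<open>sharp A \<pi> x \<alpha>\<close> is the unique vector \<open>v\<close> with \<open>\<langle>\<beta>, v\<rangle> = \<pi>(\<alpha>, \<beta>)\<close> for all \<open>\<beta>\<close>; it exists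
  because the fibres are finite-dimensional.
\<close>

definition sharp ::
  "('m, 'e, 'v::real_vector, 'k, 'z) bundle_data_scheme \<Rightarrow>
   ('m \<Rightarrow> ('v \<Rightarrow> real) \<Rightarrow> ('v \<Rightarrow> real) \<Rightarrow> real) \<Rightarrow> 'm \<Rightarrow> ('v \<Rightarrow> real) \<Rightarrow> 'v" where
  "sharp A \<pi> x \<alpha> = (THE v. v \<in> fibre A x \<and> (\<forall>\<beta>\<in>dual_fibre A x. \<beta> v = \<pi> x \<alpha> \<beta>))"

definition transpose_endo ::
  "('m, 'e, 'v, 'k, 'z) bundle_data_scheme \<Rightarrow>
   ('m \<Rightarrow> 'v \<Rightarrow> 'v) \<Rightarrow> 'm \<Rightarrow> ('v \<Rightarrow> real) \<Rightarrow> 'v \<Rightarrow> real" where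
  "transpose_endo A N x \<alpha> = covec A x (\<lambda>v. \<alpha> (N x v))"


section \<open>Lie algebroids\<close>

text \<open>
  \<open>anchor A x v f\<close> is the derivative of the function \<open>f\<close> along the tangent vector \<open>\<rho>(v)\<close> at \<open>x\<close>.
  The bracket is only relevant on smooth sections.
\<close>

record ('m, 'e, 'v, 'k) lie_algebroid_data = "('m, 'e, 'v, 'k) bundle_data" +
  anchor :: "'m \<Rightarrow> 'v \<Rightarrow> ('m \<Rightarrow> real) \<Rightarrow> real"
  bracket :: "('m \<Rightarrow> 'v) \<Rightarrow> ('m \<Rightarrow> 'v) \<Rightarrow> 'm \<Rightarrow> 'v"

definition anchor_deriv ::
  "('m, 'e, 'v, 'k, 'z) lie_algebroid_data_scheme \<Rightarrow> ('m \<Rightarrow> 'v) \<Rightarrow> ('m \<Rightarrow> real) \<Rightarrow> 'm \<Rightarrow> real" where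
  "anchor_deriv A X f = (\<lambda>x. anchor A x (X x) f)"

text \<open>
  The anchor is a vector bundle map from \<open>A\<close> to the tangent bundle. Its smoothness says that it
  maps smooth sections to smooth vector fields, i.e. to fields of tangent vectors that map smooth
  functions to smooth functions. That it is a homomorphism of Lie algebras on sections is a
  consequence of the Leibniz rule and the Jacobi identity.
\<close>

definition lie_algebroid ::
  "('m::{t2_space,second_countable_topology}, 'e::real_inner, 'v::real_vector, 'k::real_inner, 'z)
   lie_algebroid_data_scheme \<Rightarrow> bool" where
  "lie_algebroid A \<longleftrightarrow>
     vector_bundle A \<and>
     (\<forall>x. \<forall>v\<in>fibre A x. tangent_vector A x (anchor A x v)) \<and>
     (\<forall>x. \<forall>f\<in>smooth_functions A. linear_on_set (fibre A x) (\<lambda>v. anchor A x v f)) \<and>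
     (\<forall>X\<in>sections A. \<forall>f\<in>smooth_functions A. anchor_deriv A X f \<in> smooth_functions A) \<and>
     (\<forall>X\<in>sections A. \<forall>Y\<in>sections A. bracket A X Y \<in> sections A) \<and>
     (\<forall>X\<in>sections A. \<forall>Y\<in>sections A. \<forall>Z\<in>sections A. \<forall>c d.
        bracket A (\<lambda>x. c *\<^sub>R X x + d *\<^sub>R Y x) Z
          = (\<lambda>x. c *\<^sub>R bracket A X Z x + d *\<^sub>R bracket A Y Z x) \<and>
        bracket A Z (\<lambda>x. c *\<^sub>R X x + d *\<^sub>R Y x)
          = (\<lambda>x. c *\<^sub>R bracket A Z X x + d *\<^sub>R bracket A Z Y x)) \<and>
     (\<forall>X\<in>sections A. bracket A X X = (\<lambda>x. 0)) \<and>
     (\<forall>X\<in>sections A. \<forall>Y\<in>sections A. \<forall>Z\<in>sections A. \<forall>x.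
        bracket A X (bracket A Y Z) x + bracket A Y (bracket A Z X) x
          + bracket A Z (bracket A X Y) x = 0) \<and>
     (\<forall>X\<in>sections A. \<forall>Y\<in>sections A. \<forall>f\<in>smooth_functions A.
        bracket A X (\<lambda>x. f x *\<^sub>R Y x)
          = (\<lambda>x. f x *\<^sub>R bracket A X Y x + anchor_deriv A X f x *\<^sub>R Y x))"

text \<open>
  The Lie algebroid differential of a 2-form, as a 3-form evaluated on smooth sections
  (Cartan formula).
\<close>

definition differential ::
  "('m, 'e, 'v, 'k, 'z) lie_algebroid_data_scheme \<Rightarrow> ('m \<Rightarrow> 'v \<Rightarrow> 'v \<Rightarrow> real) \<Rightarrow>
   ('m \<Rightarrow> 'v) \<Rightarrow> ('m \<Rightarrow> 'v) \<Rightarrow> ('m \<Rightarrow> 'v) \<Rightarrow> 'm \<Rightarrow> real" where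
  "differential A \<omega> X Y Z = (\<lambda>x.
     anchor_deriv A X (\<lambda>y. \<omega> y (Y y) (Z y)) x
     - anchor_deriv A Y (\<lambda>y. \<omega> y (X y) (Z y)) x
     + anchor_deriv A Z (\<lambda>y. \<omega> y (X y) (Y y)) x
     - \<omega> x (bracket A X Y x) (Z x)
     + \<omega> x (bracket A X Z x) (Y x)
     - \<omega> x (bracket A Y Z x) (X x))"

definition closed_form ::
  "('m, 'e::real_inner, 'v::real_vector, 'k::real_inner, 'z) lie_algebroid_data_scheme \<Rightarrow>
   ('m \<Rightarrow> 'v \<Rightarrow> 'v \<Rightarrow> real) \<Rightarrow> bool" where
  "closed_form A \<omega> \<longleftrightarrow>
     (\<forall>X\<in>sections A. \<forall>Y\<in>sections A. \<forall>Z\<in>sections A. differential A \<omega> X Y Z = (\<lambda>x. 0))"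

definition symplectic_form ::
  "('m, 'e::real_inner, 'v::real_vector, 'k::real_inner, 'z) lie_algebroid_data_scheme \<Rightarrow>
   ('m \<Rightarrow> 'v \<Rightarrow> 'v \<Rightarrow> real) \<Rightarrow> bool" where
  "symplectic_form A \<omega> \<longleftrightarrow>
     two_form A \<omega> \<and> closed_form A \<omega> \<and>
     (\<forall>x. \<forall>v\<in>fibre A x. (\<forall>w\<in>fibre A x. \<omega> x v w = 0) \<longrightarrow> v = 0)"

definition inverse_bivector ::
  "('m, 'e::real_inner, 'v::real_vector, 'k::real_inner, 'z) bundle_data_scheme \<Rightarrow>
   ('m \<Rightarrow> 'v \<Rightarrow> 'v \<Rightarrow> real) \<Rightarrow> ('m \<Rightarrow> ('v \<Rightarrow> real) \<Rightarrow> ('v \<Rightarrow> real) \<Rightarrow> real) \<Rightarrow> bool" where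
  "inverse_bivector A \<omega> \<pi> \<longleftrightarrow>
     bivector A \<pi> \<and>
     (\<forall>x. \<forall>\<alpha>\<in>dual_fibre A x. flat A \<omega> x (sharp A \<pi> x \<alpha>) = \<alpha>) \<and>
     (\<forall>x. \<forall>v\<in>fibre A x. sharp A \<pi> x (flat A \<omega> x v) = v)"

definition nijenhuis_torsion ::
  "('m, 'e, 'v::real_vector, 'k, 'z) lie_algebroid_data_scheme \<Rightarrow> ('m \<Rightarrow> 'v \<Rightarrow> 'v) \<Rightarrow>
   ('m \<Rightarrow> 'v) \<Rightarrow> ('m \<Rightarrow> 'v) \<Rightarrow> 'm \<Rightarrow> 'v" where
  "nijenhuis_torsion A N X Y =
     (let NX = (\<lambda>x. N x (X x)); NY = (\<lambda>x. N x (Y x)) in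
      (\<lambda>x. bracket A NX NY x
         - N x (bracket A NX Y x + bracket A X NY x - N x (bracket A X Y x))))"

definition Omega_N_structure ::
  "('m, 'e::real_inner, 'v::real_vector, 'k::real_inner, 'z) lie_algebroid_data_scheme \<Rightarrow>
   ('m \<Rightarrow> 'v \<Rightarrow> 'v \<Rightarrow> real) \<Rightarrow> ('m \<Rightarrow> 'v \<Rightarrow> 'v) \<Rightarrow> bool" where
  "Omega_N_structure A \<omega> N \<longleftrightarrow>
     two_form A \<omega> \<and> bundle_endo A N \<and>
     closed_form A \<omega> \<and>
     (\<forall>X\<in>sections A. \<forall>Y\<in>sections A. nijenhuis_torsion A N X Y = (\<lambda>x. 0)) \<and>
     (\<forall>x. \<forall>v\<in>fibre A x. flat A \<omega> x (N x v) = transpose_endo A N x (flat A \<omega> x v)) \<and>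
     closed_form A (\<lambda>x v w. \<omega> x (N x v) w)"


section \<open>Hypersymplectic structures\<close>

text \<open>
  Indices range over the type \<^typ>\<open>3\<close> of integers modulo 3, in which \<open>3 = 0\<close>; so
  \<open>\<omega> 1\<close>, \<open>\<omega> 2\<close>, \<open>\<omega> 3\<close> are the three forms and index arithmetic is cyclic.
\<close>

definition transition ::
  "('m, 'e, 'v::real_vector, 'k, 'z) bundle_data_scheme \<Rightarrow>
   (3 \<Rightarrow> 'm \<Rightarrow> 'v \<Rightarrow> 'v \<Rightarrow> real) \<Rightarrow> (3 \<Rightarrow> 'm \<Rightarrow> ('v \<Rightarrow> real) \<Rightarrow> ('v \<Rightarrow> real) \<Rightarrow> real) \<Rightarrow>
   3 \<Rightarrow> 'm \<Rightarrow> 'v \<Rightarrow> 'v" where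
  "transition A \<omega> \<pi> i x v = sharp A (\<pi> (i - 1)) x (flat A (\<omega> (i + 1)) x v)"

definition hypersymplectic ::
  "('m, 'e::real_inner, 'v::real_vector, 'k::real_inner, 'z) lie_algebroid_data_scheme \<Rightarrow>
   (3 \<Rightarrow> real) \<Rightarrow>
   (3 \<Rightarrow> 'm \<Rightarrow> 'v \<Rightarrow> 'v \<Rightarrow> real) \<Rightarrow> (3 \<Rightarrow> 'm \<Rightarrow> ('v \<Rightarrow> real) \<Rightarrow> ('v \<Rightarrow> real) \<Rightarrow> real) \<Rightarrow> bool" where
  "hypersymplectic A \<epsilon> \<omega> \<pi> \<longleftrightarrow>
     (\<forall>i. symplectic_form A (\<omega> i) \<and> inverse_bivector A (\<omega> i) (\<pi> i) \<and>
        (\<epsilon> i = 1 \<or> \<epsilon> i = - 1) \<and>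
        (\<forall>x. \<forall>v\<in>fibre A x.
           transition A \<omega> \<pi> i x (transition A \<omega> \<pi> i x v) = \<epsilon> i *\<^sub>R v))"

definition induced_flat ::
  "('m, 'e, 'v::real_vector, 'k, 'z) bundle_data_scheme \<Rightarrow> (3 \<Rightarrow> real) \<Rightarrow>
   (3 \<Rightarrow> 'm \<Rightarrow> 'v \<Rightarrow> 'v \<Rightarrow> real) \<Rightarrow> (3 \<Rightarrow> 'm \<Rightarrow> ('v \<Rightarrow> real) \<Rightarrow> ('v \<Rightarrow> real) \<Rightarrow> real) \<Rightarrow>
   'm \<Rightarrow> 'v \<Rightarrow> 'v \<Rightarrow> real" where
  "induced_flat A \<epsilon> \<omega> \<pi> x v =
     (\<lambda>w. \<epsilon> 3 * \<epsilon> 2 * flat A (\<omega> 3) x (sharp A (\<pi> 1) x (flat A (\<omega> 2) x v)) w)"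

definition induced_tensor ::
  "('m, 'e, 'v::real_vector, 'k, 'z) bundle_data_scheme \<Rightarrow> (3 \<Rightarrow> real) \<Rightarrow>
   (3 \<Rightarrow> 'm \<Rightarrow> 'v \<Rightarrow> 'v \<Rightarrow> real) \<Rightarrow> (3 \<Rightarrow> 'm \<Rightarrow> ('v \<Rightarrow> real) \<Rightarrow> ('v \<Rightarrow> real) \<Rightarrow> real) \<Rightarrow>
   'm \<Rightarrow> 'v \<Rightarrow> 'v \<Rightarrow> real" where
  "induced_tensor A \<epsilon> \<omega> \<pi> x v w = induced_flat A \<epsilon> \<omega> \<pi> x v w"

end

theory Submission
  imports Defs
begin

text \<open>
  The defining relations of the transition tensors read
  \<open>\<omega>\<^sub>i\<^sub>-\<^sub>1(N\<^sub>i v, w) = \<omega>\<^sub>i\<^sub>+\<^sub>1(v, w)\<close>. When \<open>\<epsilon>\<^sub>1 \<epsilon>\<^sub>2 \<epsilon>\<^sub>3 = 1\<close> they imply that the \<open>N\<^sub>i\<close> commute, that the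
  product of two of them is a multiple of the third, and that all of them are symmetric for all
  \<open>\<omega>\<^sub>j\<close>; moreover \<open>g\<close> is a multiple of \<open>\<omega>\<^sub>i(N\<^sub>i \<cdot>, \<cdot>)\<close> for every \<open>i\<close>.

  For a closed non-degenerate form \<open>\<omega>\<close> and a symmetric \<open>N\<close> the torsion of \<open>N\<close> is, up to sign,
  \<open>d\<omega>(NX, NY, Z) - d\<omega>\<^sub>N(NX, Y, Z) - d\<omega>\<^sub>N(X, NY, Z) + d\<omega>\<^sub>N\<^sub>N(X, Y, Z)\<close> read as a vector by means of \<open>\<omega>\<close>,
  so it vanishes if \<open>\<omega>\<^sub>N\<close> and \<open>\<omega>\<^sub>N\<^sub>N\<close> are closed. This applies to the \<open>N\<^sub>i\<close> and to their products.
  By polarisation \<open>2 d\<omega>\<^sub>N\<^sub>M(X, Y, Z) = - \<omega>(C(X, Y), Z)\<close>, where \<open>C\<close> is the concomitant of commuting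
  tensors \<open>N\<close> and \<open>M\<close>; modulo the torsions of \<open>N\<close> and \<open>M\<close> the torsion of \<open>N M\<close> is \<open>N M C\<close>,
  hence \<open>C = 0\<close> and \<open>\<omega>\<^sub>N\<^sub>M\<close> is closed. This gives \<open>dg = 0\<close>.

  Reading a vector off its pairings with sections requires a section through every vector, that
  is, smooth bump functions.
\<close>

section \<open>Maps of class C\<open>\<^sup>k\<close>\<close>

text \<open>A derivative depends only on values near the point, so openness of \<open>S\<close>
  carries agreement on \<open>S\<close> over to all derivatives. Charts and trivialisations have
  arbitrary values off their domains, which makes this necessary throughout.\<close>

lemma Ck_on_cong:
  assumes "open S" "\<And>x. x \<in> S \<Longrightarrow> f x = g x" "Ck_on k f S"
  shows "Ck_on k g S"
  using assms(2,3)
proof (induction k arbitrary: f g)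
  case 0
  then show ?case using continuous_on_cong by force
next
  case (Suc k)
  have d: "(g has_derivative frechet_derivative f (at x)) (at x)" if "x \<in> S" for x
    using Suc.prems that assms(1)
    by (metis Ck_on.simps(2) frechet_derivative_works has_derivative_transform_within_open)
  then have "frechet_derivative f (at x) h = frechet_derivative g (at x) h" if "x \<in> S" for x h
    using that by (metis frechet_derivative_at)
  then have "Ck_on k (\<lambda>x. frechet_derivative g (at x) h) S" for h
    using Suc.IH[of "\<lambda>x. frechet_derivative f (at x) h" "\<lambda>x. frechet_derivative g (at x) h"]
      Suc.prems by auto
  then show ?case using d by (auto simp: differentiable_def)
qed

text \<open>\<open>Ck_on\<close> refers to the chosen \<open>frechet_derivative\<close>; uniqueness
  of derivatives allows any explicit formula \<open>f'\<close> in its place.\<close>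

lemma Ck_on_SucI:
  assumes "open S" "\<And>x. x \<in> S \<Longrightarrow> (f has_derivative f' x) (at x)"
    "\<And>h. Ck_on k (\<lambda>x. f' x h) S"
  shows "Ck_on (Suc k) f S"
proof -
  have "Ck_on k (\<lambda>x. frechet_derivative f (at x) h) S" for h
    by (rule Ck_on_cong[OF assms(1) _ assms(3)[of h]]) (metis assms(2) frechet_derivative_at)
  then show ?thesis using assms(2) by (auto simp: differentiable_def)
qed

lemma Ck_on_SucD:
  assumes "Ck_on (Suc k) f S"
  shows "x \<in> S \<Longrightarrow> (f has_derivative frechet_derivative f (at x)) (at x)"
    and "Ck_on k (\<lambda>x. frechet_derivative f (at x) h) S"
  using assms frechet_derivative_works by auto

lemma Ck_on_Suc_imp: "Ck_on (Suc k) f S \<Longrightarrow> Ck_on k f S"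
proof (induction k arbitrary: f)
  case 0
  then show ?case
    by (simp add: continuous_at_imp_continuous_on differentiable_imp_continuous_within)
next
  case (Suc k)
  have "Ck_on k (\<lambda>x. frechet_derivative f (at x) h) S" for h
    using Suc.IH Ck_on_SucD(2)[OF Suc.prems] by blast
  then show ?case using Suc.prems by simp
qed

lemma Ck_on_subset: "Ck_on k f S \<Longrightarrow> T \<subseteq> S \<Longrightarrow> Ck_on k f T"
  by (induction k arbitrary: f) (auto intro: continuous_on_subset)

lemma Ck_on_Union:
  assumes "\<And>S. S \<in> \<S> \<Longrightarrow> open S" "\<And>S. S \<in> \<S> \<Longrightarrow> Ck_on k f S"
  shows "Ck_on k f (\<Union>\<S>)"
  using assms(2)
proof (induction k arbitrary: f)
  case 0
  then show ?case using continuous_on_open_Union[of \<S> f] assms(1) by simp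
qed simp

lemma Ck_on_const: "Ck_on k (\<lambda>x. c) S"
  by (induction k arbitrary: c) auto

lemma Ck_on_add:
  assumes "open S" "Ck_on k f S" "Ck_on k g S"
  shows "Ck_on k (\<lambda>x. f x + g x) S"
  using assms(2,3)
proof (induction k arbitrary: f g)
  case 0
  then show ?case by (auto intro: continuous_on_add)
next
  case (Suc k)
  note D = Ck_on_SucD[OF Suc.prems(1)] Ck_on_SucD[OF Suc.prems(2)]
  show ?case
    by (rule Ck_on_SucI[OF assms(1) has_derivative_add[OF D(1,3)]]) (simp_all add: Suc.IH D)
qed

text \<open>By the Leibniz rule each directional derivative is a sum of two such products of one
  order less. One induction thus serves real products, scalar multiplication and inner
  products.\<close>

lemma (in bounded_bilinear) Ck_on:
  assumes "open S" "Ck_on k f S" "Ck_on k g S"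
  shows "Ck_on k (\<lambda>x. prod (f x) (g x)) S"
  using assms(2,3)
proof (induction k arbitrary: f g)
  case 0
  then show ?case by (auto intro: continuous_on)
next
  case (Suc k)
  note D = Ck_on_SucD[OF Suc.prems(1)] Ck_on_SucD[OF Suc.prems(2)]
  show ?case
  proof (rule Ck_on_SucI[OF assms(1) FDERIV[OF D(1,3)]])
    show "Ck_on k (\<lambda>x. prod (f x) (frechet_derivative g (at x) h) +
        prod (frechet_derivative f (at x) h) (g x)) S" for h
      by (intro Ck_on_add[OF assms(1)] Suc.IH D Ck_on_Suc_imp[OF Suc.prems(1)]
          Ck_on_Suc_imp[OF Suc.prems(2)])
  qed auto
qed

section \<open>Smooth functions of one real variable that are flat at 0\<close>

text \<open>This family contains \<open>exp (- 1 / t)\<close> and is closed under differentiation.\<close>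

definition flat_exp :: "real poly \<Rightarrow> real \<Rightarrow> real" where
  "flat_exp p t = (if t > 0 then poly p (inverse t) * exp (- inverse t) else 0)"

lemma poly_div_exp_tendsto_0: "((\<lambda>s. poly p s * exp (- s)) \<longlongrightarrow> (0::real)) at_top"
proof -
  have "((\<lambda>s. \<Sum>i\<le>degree p. coeff p i * (s ^ i / exp s)) \<longlongrightarrow> (\<Sum>i\<le>degree p. coeff p i * 0)) at_top"
    by (intro tendsto_sum tendsto_mult tendsto_const tendsto_power_div_exp_0)
  then show ?thesis
    by (simp add: poly_altdef sum_distrib_right exp_minus divide_inverse mult.assoc)
qed

text \<open>With \<open>s = inverse t\<close> and \<open>ds/dt = - s^2\<close>, the derivative of
  \<open>p(s) exp(-s)\<close> is \<open>s^2 (p(s) - p'(s)) exp(-s)\<close>, again a member of the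
  family. Only the point 0 needs a limit argument.\<close>

lemma flat_exp_has_derivative:
  "(flat_exp p has_real_derivative flat_exp ([:0, 0, 1:] * (p - pderiv p)) t) (at t)"
proof (cases t "0::real" rule: linorder_cases)
  case less
  have "((\<lambda>t. 0) has_real_derivative 0) (at t)" by simp
  then have "(flat_exp p has_real_derivative 0) (at t)"
    by (rule has_field_derivative_transform_within_open[of _ _ _ "{..<0}"])
       (use less in \<open>auto simp: flat_exp_def\<close>)
  then show ?thesis using less by (simp add: flat_exp_def)
next
  case greater
  have "((\<lambda>t. poly p (inverse t) * exp (- inverse t)) has_real_derivative
      flat_exp ([:0, 0, 1:] * (p - pderiv p)) t) (at t)"
    using greater
    by (auto intro!: derivative_eq_intros DERIV_chain2[OF poly_DERIV]
        simp: flat_exp_def field_simps power2_eq_square)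
  then show ?thesis
    by (rule has_field_derivative_transform_within_open[of _ _ _ "{0<..}"])
       (use greater in \<open>auto simp: flat_exp_def\<close>)
next
  case equal
  \<comment> \<open>Dividing by \<open>t\<close> multiplies by \<open>s = inverse t\<close>: the
    difference quotient from the right is \<open>s p(s) exp(-s)\<close>, and the exponential beats
    the polynomial as \<open>s\<close> tends to infinity.\<close>
  have "((\<lambda>t. poly ([:0, 1:] * p) (inverse t) * exp (- inverse t)) \<longlongrightarrow> 0) (at_right 0)"
    by (rule filterlim_compose[OF poly_div_exp_tendsto_0 filterlim_inverse_at_top_right])
  then have "((\<lambda>y. flat_exp p y / y) \<longlongrightarrow> 0) (at_right 0)"
    by (rule Lim_transform_eventually)
       (auto simp: flat_exp_def divide_inverse mult_ac
        intro!: eventually_at_right_less[THEN eventually_mono])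
  moreover have "((\<lambda>y. flat_exp p y / y) \<longlongrightarrow> 0) (at_left 0)"
    by (rule Lim_transform_eventually[of "\<lambda>_. 0"])
       (auto simp: flat_exp_def eventually_at_filter)
  ultimately have "((\<lambda>y. flat_exp p y / y) \<longlongrightarrow> 0) (at 0)"
    by (simp add: filterlim_split_at)
  then show ?thesis using equal
    by (simp add: has_field_derivative_iff flat_exp_def)
qed

text \<open>The induction keeps \<open>p\<close> arbitrary, because the chain rule replaces
  \<open>p\<close> by the polynomial of the derivative.\<close>

lemma Ck_on_flat_exp:
  assumes "open S" "Ck_on k u S"
  shows "Ck_on k (\<lambda>x. flat_exp p (u x)) S"
  using assms(2)
proof (induction k arbitrary: p)
  case 0
  have "continuous_on UNIV (flat_exp p)"
    using flat_exp_has_derivative DERIV_isCont by (blast intro: continuous_at_imp_continuous_on)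
  then show ?case using 0 by (auto intro: continuous_on_compose2)
next
  case (Suc k)
  let ?q = "[:0, 0, 1:] * (p - pderiv p)"
  show ?case
  proof (rule Ck_on_SucI[OF assms(1)])
    fix x assume "x \<in> S"
    then show "((\<lambda>x. flat_exp p (u x)) has_derivative
        (\<lambda>h. flat_exp ?q (u x) * frechet_derivative u (at x) h)) (at x)"
      using has_derivative_compose[OF Ck_on_SucD(1)[OF Suc.prems]
          flat_exp_has_derivative[THEN has_field_derivative_imp_has_derivative]] by simp
  next
    fix h show "Ck_on k (\<lambda>x. flat_exp ?q (u x) * frechet_derivative u (at x) h) S"
      by (rule bounded_bilinear.Ck_on[OF bounded_bilinear_mult assms(1)
            Suc.IH[OF Ck_on_Suc_imp[OF Suc.prems]] Ck_on_SucD(2)[OF Suc.prems]])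
  qed
qed

lemma Ck_on_sum:
  assumes "open S" "\<And>i. i \<in> I \<Longrightarrow> Ck_on k (f i) S"
  shows "Ck_on k (\<lambda>x. \<Sum>i\<in>I. f i x) S"
  using assms(2)
  by (induction I rule: infinite_finite_induct) (auto intro: Ck_on_const Ck_on_add assms(1))

section \<open>Finite-dimensional inner product spaces: coordinates and compact balls\<close>

lemma finite_dim_expansion:
  assumes "finite_dim_space TYPE('k)"
  obtains C :: "'k::real_inner set" and d where "finite C" "\<And>v. v = (\<Sum>c\<in>C. (v \<bullet> d c) *\<^sub>R c)"
proof -
  obtain B :: "'k set" where "finite B" "span B = UNIV"
    using assms by (auto simp: finite_dim_space_def)
  then obtain C :: "'k set" where C: "finite C" "span C = UNIV" "pairwise orthogonal C"
    using basis_orthogonal by metis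
  \<comment> \<open>By orthogonality the coefficient of \<open>c\<close> is the inner product with
    \<open>c\<close> divided by \<open>c \<bullet> c\<close>. Should 0 lie in \<open>C\<close>,
    division by zero gives \<open>d 0 = 0\<close>, and its term vanishes in any case.\<close>
  define d where "d c = c /\<^sub>R (c \<bullet> c)" for c :: 'k
  have "v = (\<Sum>c\<in>C. (v \<bullet> d c) *\<^sub>R c)" for v
  proof -
    have "v \<in> span C" using C by simp
    then show ?thesis
    proof (induction rule: span_induct_alt)
      case base
      then show ?case by simp
    next
      case (step a x y)
      have "(\<Sum>c\<in>C. (x \<bullet> d c) *\<^sub>R c) = (\<Sum>c\<in>C. if c = x then x else 0)"
        using C(3) step(1)
        by (intro sum.cong) (cases "x = 0"; auto simp: d_def pairwise_def orthogonal_def)+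
      also have "\<dots> = x" using C(1) step(1) by simp
      finally have "a *\<^sub>R x + y = a *\<^sub>R (\<Sum>c\<in>C. (x \<bullet> d c) *\<^sub>R c) + (\<Sum>c\<in>C. (y \<bullet> d c) *\<^sub>R c)"
        using step(2) by simp
      then show ?case
        by (rule trans) (simp add: inner_add_left scaleR_add_left sum.distrib scaleR_sum_right)
    qed
  qed
  then show thesis using that C(1) by blast
qed

text \<open>The ball is a closed subset of the combinations with bounded coefficients. That set is
  compact by adding one coefficient at a time: it is a continuous image of an interval times a
  compact set.\<close>

lemma finite_dim_compact_cball:
  assumes "finite_dim_space TYPE('k)"
  shows "compact (cball (a::'k::real_inner) r)"
proof -
  obtain C :: "'k set" and d where C: "finite C" "\<And>v. v = (\<Sum>c\<in>C. (v \<bullet> d c) *\<^sub>R c)"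
    using finite_dim_expansion[OF assms] by blast
  \<comment> \<open>The Cauchy-Schwarz bound for \<open>v \<bullet> d c\<close> on the ball, where
    \<open>norm v \<le> norm a + r\<close>.\<close>
  define B where "B c = (norm a + r) * norm (d c)" for c
  define S where "S D = {\<Sum>c\<in>D. t c *\<^sub>R c | t. \<forall>c\<in>D. \<bar>t c\<bar> \<le> B c}" for D :: "'k set"
  have "compact (S D)" if "finite D" for D
    using that
  proof (induction D)
    case empty
    then show ?case by (simp add: S_def)
  next
    case (insert e D)
    have "S (insert e D) = (\<lambda>(s, v). s *\<^sub>R e + v) ` ({- (B e)..B e} \<times> S D)"
    proof (intro equalityI subsetI)
      fix v assume "v \<in> S (insert e D)"
      then obtain t where "v = t e *\<^sub>R e + (\<Sum>c\<in>D. t c *\<^sub>R c)"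
        "\<forall>c\<in>insert e D. \<bar>t c\<bar> \<le> B c"
        using insert by (auto simp: S_def)
      then show "v \<in> (\<lambda>(s, v). s *\<^sub>R e + v) ` ({- (B e)..B e} \<times> S D)"
        unfolding S_def by (force simp: abs_le_iff)
    next
      fix v assume "v \<in> (\<lambda>(s, v). s *\<^sub>R e + v) ` ({- (B e)..B e} \<times> S D)"
      then obtain s t where *: "v = s *\<^sub>R e + (\<Sum>c\<in>D. t c *\<^sub>R c)" "\<bar>s\<bar> \<le> B e"
        "\<forall>c\<in>D. \<bar>t c\<bar> \<le> B c"
        by (auto simp: S_def abs_le_iff)
      have "v = (\<Sum>c\<in>insert e D. (t(e := s)) c *\<^sub>R c)"
        using * insert by (auto intro!: sum.cong)
      moreover have "\<forall>c\<in>insert e D. \<bar>(t(e := s)) c\<bar> \<le> B c" using * insert by auto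
      ultimately show "v \<in> S (insert e D)" unfolding S_def by blast
    qed
    moreover have "compact ({- (B e)..B e} \<times> S D)"
      using insert.IH by (intro compact_Times) auto
    ultimately show ?case
      by (auto intro!: compact_continuous_image continuous_intros simp: case_prod_unfold)
  qed
  then have "compact (S C \<inter> cball a r)" using C(1) by (auto intro: compact_Int_closed)
  moreover have "cball a r \<subseteq> S C"
  proof
    fix v assume "v \<in> cball a r"
    then have "norm v \<le> norm a + r" unfolding mem_cball
      by (metis add_left_mono dist_commute norm_triangle_sub dist_norm order_trans)
    then have "\<bar>v \<bullet> d c\<bar> \<le> B c" for c
      using Cauchy_Schwarz_ineq2[of v "d c"] unfolding B_def by (meson mult_right_mono norm_ge_zero order_trans)
    then show "v \<in> S C" using C(2)[of v] unfolding S_def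
      by (intro CollectI exI[of _ "\<lambda>c. v \<bullet> d c"]) auto
  qed
  ultimately show ?thesis by (simp add: Int_absorb1)
qed

section \<open>Smooth maps on manifolds\<close>

lemma smooth_manifoldD:
  assumes "smooth_manifold (M::('m::{t2_space,second_countable_topology}, 'e::real_inner, 'z) manifold_data_scheme)"
  shows "finite_dim_space TYPE('e)" "\<exists>(U, \<phi>)\<in>charts M. x \<in> U"
    and "(U, \<phi>) \<in> charts M \<Longrightarrow> open U"
    and "(U, \<phi>) \<in> charts M \<Longrightarrow> homeomorphism U (\<phi> ` U) \<phi> (inv_into U \<phi>)"
    and "(U, \<phi>) \<in> charts M \<Longrightarrow> open W \<Longrightarrow> open (\<phi> ` (U \<inter> W))"
    and "(U, \<phi>) \<in> charts M \<Longrightarrow> x \<in> U \<Longrightarrow> inv_into U \<phi> (\<phi> x) = x"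
    and "(U, \<phi>) \<in> charts M \<Longrightarrow> (V, \<psi>) \<in> charts M \<Longrightarrow>
          smooth_on (\<lambda>y. \<psi> (inv_into U \<phi> y)) (\<phi> ` (U \<inter> V))"
proof -
  show "finite_dim_space TYPE('e)" using assms by (simp add: smooth_manifold_def)
  have "x \<in> (\<Union>(U, \<phi>)\<in>charts M. U)" using assms by (simp add: smooth_manifold_def)
  then show "\<exists>(U, \<phi>)\<in>charts M. x \<in> U" by blast
  have *: "open U" "open (\<phi> ` U)" "homeomorphism U (\<phi> ` U) \<phi> (inv_into U \<phi>)"
    if "(U, \<phi>) \<in> charts M" for U \<phi>
    using assms that by (auto simp: smooth_manifold_def)
  { assume U: "(U, \<phi>) \<in> charts M"
    show "open U" "homeomorphism U (\<phi> ` U) \<phi> (inv_into U \<phi>)" using *[OF U] by auto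
    show "open (\<phi> ` (U \<inter> W))" if "open W"
      using homeomorphism_imp_open_map[OF *(3)[OF U], of "U \<inter> W"] *[OF U] that
      by (metis inf_le1 open_openin_trans openin_open_eq openin_open_Int)
    show "x \<in> U \<Longrightarrow> inv_into U \<phi> (\<phi> x) = x"
      using *(3)[OF U] by (simp add: homeomorphism_def)
    show "(V, \<psi>) \<in> charts M \<Longrightarrow> smooth_on (\<lambda>y. \<psi> (inv_into U \<phi> y)) (\<phi> ` (U \<inter> V))"
      using assms U unfolding smooth_manifold_def by blast
  }
qed

context
  fixes M :: "('m::{t2_space,second_countable_topology}, 'e::real_inner, 'z) manifold_data_scheme"
  assumes M: "smooth_manifold M"
begin

lemma smooth_map_on_iff_Ck_on:
  "smooth_map_on M W f \<longleftrightarrow>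
     (\<forall>U \<phi> k. (U, \<phi>) \<in> charts M \<longrightarrow> Ck_on k (\<lambda>y. f (inv_into U \<phi> y)) (\<phi> ` (U \<inter> W)))"
  by (auto simp: smooth_map_on_def smooth_on_def)

lemma smooth_map_on_cong:
  assumes "open W" "\<And>x. x \<in> W \<Longrightarrow> f x = g x" "smooth_map_on M W f"
  shows "smooth_map_on M W g"
  unfolding smooth_map_on_iff_Ck_on
proof (intro allI impI)
  fix U \<phi> k assume U: "(U, \<phi>) \<in> charts M"
  show "Ck_on k (\<lambda>y. g (inv_into U \<phi> y)) (\<phi> ` (U \<inter> W))"
    by (rule Ck_on_cong[OF smooth_manifoldD(5)[OF M U assms(1)], of "\<lambda>y. f (inv_into U \<phi> y)"])
       (use assms U smooth_manifoldD(6)[OF M U] in \<open>auto simp: smooth_map_on_iff_Ck_on\<close>)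
qed

lemma smooth_map_on_subset: "smooth_map_on M W f \<Longrightarrow> V \<subseteq> W \<Longrightarrow> smooth_map_on M V f"
  unfolding smooth_map_on_iff_Ck_on
  by (meson Ck_on_subset Int_mono image_mono order_refl)

lemma smooth_map_on_Union:
  assumes "\<And>W. W \<in> \<W> \<Longrightarrow> open W" "\<And>W. W \<in> \<W> \<Longrightarrow> smooth_map_on M W f"
  shows "smooth_map_on M (\<Union>\<W>) f"
  unfolding smooth_map_on_iff_Ck_on
proof (intro allI impI)
  fix U \<phi> k assume U: "(U, \<phi>) \<in> charts M"
  have "\<phi> ` (U \<inter> \<Union>\<W>) = \<Union>((\<lambda>W. \<phi> ` (U \<inter> W)) ` \<W>)" by auto
  then show "Ck_on k (\<lambda>y. f (inv_into U \<phi> y)) (\<phi> ` (U \<inter> \<Union>\<W>))"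
    using assms U smooth_manifoldD(5)[OF M U]
    by (auto intro!: Ck_on_Union simp: smooth_map_on_iff_Ck_on)
qed

lemma smooth_map_on_const: "smooth_map_on M W (\<lambda>x. c)"
  by (simp add: smooth_map_on_iff_Ck_on Ck_on_const)

lemma smooth_map_on_add:
  assumes "open W" "smooth_map_on M W f" "smooth_map_on M W g"
  shows "smooth_map_on M W (\<lambda>x. f x + g x)"
  using assms(2,3) smooth_manifoldD(5)[OF M _ assms(1)]
  by (auto intro!: Ck_on_add simp: smooth_map_on_iff_Ck_on)

lemma smooth_map_on_sum:
  assumes "open W" "\<And>i. i \<in> I \<Longrightarrow> smooth_map_on M W (f i)"
  shows "smooth_map_on M W (\<lambda>x. \<Sum>i\<in>I. f i x)"
  using assms(2) smooth_manifoldD(5)[OF M _ assms(1)]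
  by (auto intro!: Ck_on_sum simp: smooth_map_on_iff_Ck_on)

lemma smooth_map_on_bilinear:
  assumes "bounded_bilinear p" "open W" "smooth_map_on M W f" "smooth_map_on M W g"
  shows "smooth_map_on M W (\<lambda>x. p (f x) (g x))"
  using assms(3,4) smooth_manifoldD(5)[OF M _ assms(2)]
  by (auto intro!: bounded_bilinear.Ck_on[OF assms(1)] simp: smooth_map_on_iff_Ck_on)

lemmas smooth_map_on_mult = smooth_map_on_bilinear[OF bounded_bilinear_mult]
lemmas smooth_map_on_scaleR = smooth_map_on_bilinear[OF bounded_bilinear_scaleR]

text \<open>In a chart, \<open>exp (- 1 / t)\<close> is applied to \<open>r^2\<close> minus the
  squared distance from the centre, and the result is extended by 0. Smoothness is local:
  \<open>U\<close> and \<open>- K\<close> are open and cover the manifold, and \<open>f\<close>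
  vanishes on \<open>- K\<close>.\<close>

lemma smooth_bump:
  assumes "open W" "x \<in> W"
  obtains f K where "smooth_map_on M UNIV f" "f x = (1::real)" "closed K" "K \<subseteq> W"
    "\<And>y. y \<notin> K \<Longrightarrow> f y = 0"
proof -
  obtain U \<phi> where U: "(U, \<phi>) \<in> charts M" "x \<in> U"
    using smooth_manifoldD(2)[OF M, of x] by auto
  have hom: "homeomorphism U (\<phi> ` U) \<phi> (inv_into U \<phi>)" by (rule smooth_manifoldD(4)[OF M U(1)])
  have "open (\<phi> ` (U \<inter> W))" by (rule smooth_manifoldD(5)[OF M U(1) assms(1)])
  then obtain r where r: "r > 0" "cball (\<phi> x) r \<subseteq> \<phi> ` (U \<inter> W)"
    using U(2) assms(2) by (metis IntI imageI open_contains_cball)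
  \<comment> \<open>A closed ball pulled back from the chart. Being compact in a Hausdorff space it
    is closed in the whole manifold, not merely in \<open>U\<close>.\<close>
  define K where "K = inv_into U \<phi> ` cball (\<phi> x) r"
  have "compact K" unfolding K_def
    using hom r(2) finite_dim_compact_cball[OF smooth_manifoldD(1)[OF M]]
    by (intro compact_continuous_image) (auto simp: homeomorphism_def intro: continuous_on_subset)
  then have K: "closed K" by (rule compact_imp_closed)
  have KW: "K \<subseteq> U \<inter> W" using r(2) smooth_manifoldD(6)[OF M U(1)] by (auto simp: K_def)
  \<comment> \<open>Positive exactly over the open ball, so \<open>flat_exp 1\<close> cuts off at
    its boundary.\<close>
  define q where "q y = r\<^sup>2 - (\<phi> y - \<phi> x) \<bullet> (\<phi> y - \<phi> x)" for y
  define f where "f y = (if y \<in> U then flat_exp 1 (q y) else 0)" for y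
  have f0: "f y = 0" if "y \<notin> K" for y
  proof (cases "y \<in> U")
    case True
    have "\<phi> y \<notin> cball (\<phi> x) r"
      using that True smooth_manifoldD(6)[OF M U(1) True] unfolding K_def by force
    then have "r\<^sup>2 < (norm (\<phi> y - \<phi> x))\<^sup>2"
      using r(1) by (auto simp: dist_norm norm_minus_commute intro!: power_strict_mono)
    then show ?thesis by (simp add: f_def q_def flat_exp_def dot_square_norm)
  qed (simp add: f_def)
  have "smooth_map_on M U \<phi>"
    using smooth_manifoldD(7)[OF M _ U(1)] by (auto simp: smooth_map_on_def)
  then have "smooth_map_on M U (\<lambda>y. \<phi> y + - \<phi> x)"
    by (intro smooth_map_on_add smooth_map_on_const smooth_manifoldD(3)[OF M U(1)])
  then have "smooth_map_on M U (\<lambda>y. r\<^sup>2 + (- 1) * ((\<phi> y - \<phi> x) \<bullet> (\<phi> y - \<phi> x)))"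
    by (intro smooth_map_on_add smooth_map_on_mult smooth_map_on_bilinear[OF bounded_bilinear_inner]
        smooth_map_on_const smooth_manifoldD(3)[OF M U(1)]) simp_all
  then have "smooth_map_on M U q" by (simp add: q_def[abs_def])
  then have "smooth_map_on M U (\<lambda>y. flat_exp 1 (q y))"
    unfolding smooth_map_on_iff_Ck_on
    using smooth_manifoldD(5)[OF M _ smooth_manifoldD(3)[OF M U(1)]] by (auto intro!: Ck_on_flat_exp)
  then have "smooth_map_on M U f"
    by (rule smooth_map_on_cong[rotated 2]) (auto simp: f_def smooth_manifoldD(3)[OF M U(1)])
  moreover have "smooth_map_on M (- K) f"
    by (rule smooth_map_on_cong[OF _ _ smooth_map_on_const[of _ 0]]) (use f0 K in auto)
  ultimately have "smooth_map_on M (\<Union>{U, - K}) f"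
    using K smooth_manifoldD(3)[OF M U(1)] by (intro smooth_map_on_Union) auto
  moreover have "\<Union>{U, - K} = UNIV" using KW by auto
  ultimately have f: "smooth_map_on M UNIV f" by simp
  have "f x > 0" using U(2) r(1) by (simp add: f_def q_def flat_exp_def)
  show thesis
  proof
    show "smooth_map_on M UNIV (\<lambda>y. inverse (f x) * f y)"
      by (intro smooth_map_on_mult smooth_map_on_const f) simp
    show "inverse (f x) * f x = 1" using \<open>f x > 0\<close> by simp
  qed (use K KW f0 in auto)
qed

end

section \<open>Sections and tensors of vector bundles\<close>

lemma linear_on_set_add: "linear_on_set S f \<Longrightarrow> u \<in> S \<Longrightarrow> v \<in> S \<Longrightarrow> f (u + v) = f u + f v"
  and linear_on_set_scale: "linear_on_set S f \<Longrightarrow> v \<in> S \<Longrightarrow> f (c *\<^sub>R v) = c *\<^sub>R f v"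
  by (auto simp: linear_on_set_def)

lemma linear_on_set_0: "linear_on_set S f \<Longrightarrow> subspace S \<Longrightarrow> f 0 = 0"
  using linear_on_set_scale[of S f 0 0] by (simp add: subspace_0)

lemma linear_on_set_diff:
  "linear_on_set S f \<Longrightarrow> subspace S \<Longrightarrow> u \<in> S \<Longrightarrow> v \<in> S \<Longrightarrow> f (u - v) = f u - f v"
  using linear_on_set_add[of S f u "(-1) *\<^sub>R v"] linear_on_set_scale[of S f v "-1"]
    subspace_scale[of S v "-1"] by simp

lemma linear_on_set_sum:
  assumes "linear_on_set S f" "subspace S" "\<And>i. i \<in> I \<Longrightarrow> g i \<in> S"
  shows "f (\<Sum>i\<in>I. t i *\<^sub>R g i) = (\<Sum>i\<in>I. t i *\<^sub>R f (g i))"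
  using assms(3)
proof (induction I rule: infinite_finite_induct)
  case (insert i I)
  then show ?case
    using linear_on_set_add[OF assms(1), of "t i *\<^sub>R g i" "\<Sum>i\<in>I. t i *\<^sub>R g i"]
      linear_on_set_scale[OF assms(1), of "g i"] assms(2)
    by (simp add: subspace_sum subspace_scale)
qed (simp_all add: linear_on_set_0[OF assms(1,2)])

lemma covec_in_dual_fibre:
  assumes "subspace (fibre A x)" "linear_on_set (fibre A x) \<alpha>"
  shows "covec A x \<alpha> \<in> dual_fibre A x"
  using assms by (auto simp: dual_fibre_def covec_def linear_on_set_def subspace_add subspace_scale)

lemma vector_bundleD:
  assumes "vector_bundle A"
  shows "smooth_manifold A" "subspace (fibre A x)"
    and "\<exists>(U, \<tau>)\<in>trivs A. x \<in> U"
    and "(U, \<tau>) \<in> trivs A \<Longrightarrow> open U"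
    and "(U, \<tau>) \<in> trivs A \<Longrightarrow> x \<in> U \<Longrightarrow> linear_on_set (fibre A x) (\<tau> x)"
    and "(U, \<tau>) \<in> trivs A \<Longrightarrow> x \<in> U \<Longrightarrow> inv_into (fibre A x) (\<tau> x) a \<in> fibre A x"
    and "(U, \<tau>) \<in> trivs A \<Longrightarrow> x \<in> U \<Longrightarrow> \<tau> x (inv_into (fibre A x) (\<tau> x) a) = a"
    and "(U, \<tau>) \<in> trivs A \<Longrightarrow> x \<in> U \<Longrightarrow> v \<in> fibre A x \<Longrightarrow> inv_into (fibre A x) (\<tau> x) (\<tau> x v) = v"
    and "(U, \<tau>) \<in> trivs A \<Longrightarrow> (V, \<sigma>) \<in> trivs A \<Longrightarrow>
           smooth_map_on A (U \<inter> V) (\<lambda>x. \<sigma> x (inv_into (fibre A x) (\<tau> x) a))"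
proof -
  show "smooth_manifold A" "subspace (fibre A x)" using assms by (auto simp: vector_bundle_def)
  have "x \<in> (\<Union>(U, \<tau>)\<in>trivs A. U)" using assms by (simp add: vector_bundle_def)
  then show "\<exists>(U, \<tau>)\<in>trivs A. x \<in> U" by blast
  show "(U, \<tau>) \<in> trivs A \<Longrightarrow> open U"
    and "(U, \<tau>) \<in> trivs A \<Longrightarrow> x \<in> U \<Longrightarrow> linear_on_set (fibre A x) (\<tau> x)"
    and "(U, \<tau>) \<in> trivs A \<Longrightarrow> (V, \<sigma>) \<in> trivs A \<Longrightarrow>
           smooth_map_on A (U \<inter> V) (\<lambda>x. \<sigma> x (inv_into (fibre A x) (\<tau> x) a))"
    using assms unfolding vector_bundle_def by blast+
  { assume "(U, \<tau>) \<in> trivs A" "x \<in> U"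
    then have b: "bij_betw (\<tau> x) (fibre A x) UNIV"
      using assms unfolding vector_bundle_def by blast
    show "inv_into (fibre A x) (\<tau> x) a \<in> fibre A x"
      using b by (metis UNIV_I bij_betw_imp_surj_on inv_into_into)
    show "\<tau> x (inv_into (fibre A x) (\<tau> x) a) = a"
      using b by (metis UNIV_I bij_betw_imp_surj_on f_inv_into_f)
    show "v \<in> fibre A x \<Longrightarrow> inv_into (fibre A x) (\<tau> x) (\<tau> x v) = v"
      using b by (metis bij_betw_imp_inj_on inv_into_f_f)
  }
qed

context
  fixes A :: "('m::{t2_space,second_countable_topology}, 'e::real_inner, 'v::real_vector,
               'k::real_inner, 'z) bundle_data_scheme"
  assumes A: "vector_bundle A"
begin

section \<open>Local frames, smoothness of contractions, and sections through a vector\<close>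

lemma fibre_type_expansion:
  obtains C :: "'k set" and d where "finite C" "\<And>u. u = (\<Sum>c\<in>C. (u \<bullet> d c) *\<^sub>R c)"
proof -
  have "finite_dim_space TYPE('k)" using A by (simp add: vector_bundle_def)
  then show thesis by (rule finite_dim_expansion) (rule that)
qed

text \<open>The vectors that \<open>\<tau> x\<close> maps to the elements of \<open>C\<close> span
  the fibre, and \<open>f\<close> is linear. This reduces smoothness of a tensor applied to sections
  to smoothness of its components.\<close>

lemma frame_expansion:
  assumes C: "\<And>u. u = (\<Sum>c\<in>C. (u \<bullet> d c) *\<^sub>R c)"
    and U: "(U, \<tau>) \<in> trivs A" "x \<in> U" and v: "v \<in> fibre A x"
    and f: "linear_on_set (fibre A x) f"
  shows "f v = (\<Sum>c\<in>C. (\<tau> x v \<bullet> d c) *\<^sub>R f (inv_into (fibre A x) (\<tau> x) c))"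
proof -
  let ?w = "\<Sum>c\<in>C. (\<tau> x v \<bullet> d c) *\<^sub>R inv_into (fibre A x) (\<tau> x) c"
  have "\<tau> x ?w = (\<Sum>c\<in>C. (\<tau> x v \<bullet> d c) *\<^sub>R \<tau> x (inv_into (fibre A x) (\<tau> x) c))"
    by (intro linear_on_set_sum[OF vector_bundleD(5)[OF A U]] vector_bundleD(2)[OF A]
        vector_bundleD(6)[OF A U])
  also have "\<dots> = \<tau> x v"
    using C[of "\<tau> x v"] vector_bundleD(7)[OF A U] by simp
  finally have "\<tau> x ?w = \<tau> x v" .
  moreover have "?w \<in> fibre A x"
    by (intro subspace_sum subspace_scale vector_bundleD(2)[OF A] vector_bundleD(6)[OF A U])
  ultimately have "v = ?w"
    using vector_bundleD(8)[OF A U] v by metis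
  then have "f v = f ?w" by (rule arg_cong)
  also have "\<dots> = (\<Sum>c\<in>C. (\<tau> x v \<bullet> d c) *\<^sub>R f (inv_into (fibre A x) (\<tau> x) c))"
    by (intro linear_on_set_sum[OF f] vector_bundleD(2)[OF A] vector_bundleD(6)[OF A U])
  finally show ?thesis .
qed

lemma smooth_two_form_apply:
  assumes \<omega>: "two_form A \<omega>" and U: "(U, \<tau>) \<in> trivs A"
    and X: "\<And>x. x \<in> U \<Longrightarrow> X x \<in> fibre A x" "smooth_map_on A U (\<lambda>x. \<tau> x (X x))"
    and Y: "\<And>x. x \<in> U \<Longrightarrow> Y x \<in> fibre A x" "smooth_map_on A U (\<lambda>x. \<tau> x (Y x))"
  shows "smooth_map_on A U (\<lambda>x. \<omega> x (X x) (Y x))"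
proof -
  let ?E = "\<lambda>x. inv_into (fibre A x) (\<tau> x)"
  obtain C :: "'k set" and d where C: "\<And>u. u = (\<Sum>c\<in>C. (u \<bullet> d c) *\<^sub>R c)"
    by (rule fibre_type_expansion) (rule that)
  note X' = frame_expansion[OF C U _ X(1)] and Y' = frame_expansion[OF C U _ Y(1)]
  note op = vector_bundleD(4)[OF A U]
  have "smooth_map_on A U (\<lambda>x. \<omega> x (?E x c) (?E x e))" for c e
    using \<omega> U unfolding two_form_def by blast
  then have "smooth_map_on A U (\<lambda>x. \<Sum>c\<in>C. (\<tau> x (X x) \<bullet> d c) *
      (\<Sum>e\<in>C. (\<tau> x (Y x) \<bullet> d e) * \<omega> x (?E x c) (?E x e)))"
    by (intro smooth_map_on_sum[OF vector_bundleD(1)[OF A] op]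
        smooth_map_on_mult[OF vector_bundleD(1)[OF A] op]
        smooth_map_on_bilinear[OF vector_bundleD(1)[OF A] bounded_bilinear_inner op]
        smooth_map_on_const[OF vector_bundleD(1)[OF A]] X(2) Y(2))
  then show ?thesis
  proof (rule smooth_map_on_cong[OF vector_bundleD(1)[OF A] op, rotated])
    fix x assume x: "x \<in> U"
    have l: "linear_on_set (fibre A x) (\<omega> x v)" "linear_on_set (fibre A x) (\<lambda>u. \<omega> x u v)"
      if "v \<in> fibre A x" for v
      using \<omega> that by (auto simp: two_form_def)
    have "\<omega> x (X x) (Y x) = (\<Sum>c\<in>C. (\<tau> x (X x) \<bullet> d c) * \<omega> x (?E x c) (Y x))"
      using X'[OF x x l(2)[OF Y(1)[OF x]]] by simp
    then show "(\<Sum>c\<in>C. (\<tau> x (X x) \<bullet> d c) *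
      (\<Sum>e\<in>C. (\<tau> x (Y x) \<bullet> d e) * \<omega> x (?E x c) (?E x e))) = \<omega> x (X x) (Y x)"
      using Y'[OF x x l(1)[OF vector_bundleD(6)[OF A U x]]] by simp
  qed
qed

lemma sectionsD:
  assumes "X \<in> sections A"
  shows "X x \<in> fibre A x" "(U, \<tau>) \<in> trivs A \<Longrightarrow> smooth_map_on A U (\<lambda>x. \<tau> x (X x))"
  using assms by (auto simp: sections_def)

lemma two_form_sections_smooth:
  assumes "two_form A \<omega>" "X \<in> sections A" "Y \<in> sections A"
  shows "(\<lambda>x. \<omega> x (X x) (Y x)) \<in> smooth_functions A"
proof -
  have "smooth_map_on A (\<Union>(fst ` trivs A)) (\<lambda>x. \<omega> x (X x) (Y x))"
    using smooth_two_form_apply[OF assms(1)] sectionsD[OF assms(2)] sectionsD[OF assms(3)]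
      vector_bundleD(4)[OF A]
    by (intro smooth_map_on_Union vector_bundleD(1)[OF A]) fastforce+
  moreover have "\<Union>(fst ` trivs A) = UNIV" using vector_bundleD(3)[OF A] by force
  ultimately show ?thesis by (simp add: smooth_functions_def)
qed

lemma bundle_endoD:
  assumes "bundle_endo A N"
  shows "v \<in> fibre A x \<Longrightarrow> N x v \<in> fibre A x" "linear_on_set (fibre A x) (N x)"
    "(U, \<tau>) \<in> trivs A \<Longrightarrow> smooth_map_on A U (\<lambda>x. \<tau> x (N x (inv_into (fibre A x) (\<tau> x) a)))"
  using assms unfolding bundle_endo_def by blast+

lemma smooth_frame:
  assumes "(U, \<tau>) \<in> trivs A"
  shows "smooth_map_on A U (\<lambda>x. \<tau> x (inv_into (fibre A x) (\<tau> x) a))"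
  by (rule smooth_map_on_cong[OF vector_bundleD(1)[OF A] vector_bundleD(4)[OF A assms] _
        smooth_map_on_const[OF vector_bundleD(1)[OF A]], of a])
     (simp add: vector_bundleD(7)[OF A assms])

lemma smooth_endo_apply:
  assumes N: "bundle_endo A N" and U: "(U, \<tau>) \<in> trivs A"
    and X: "\<And>x. x \<in> U \<Longrightarrow> X x \<in> fibre A x" "smooth_map_on A U (\<lambda>x. \<tau> x (X x))"
  shows "smooth_map_on A U (\<lambda>x. \<tau> x (N x (X x)))"
proof -
  let ?E = "\<lambda>x. inv_into (fibre A x) (\<tau> x)"
  obtain C :: "'k set" and d where C: "\<And>u. u = (\<Sum>c\<in>C. (u \<bullet> d c) *\<^sub>R c)"
    by (rule fibre_type_expansion) (rule that)
  note op = vector_bundleD(4)[OF A U]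
  have "smooth_map_on A U (\<lambda>x. \<Sum>c\<in>C. (\<tau> x (X x) \<bullet> d c) *\<^sub>R \<tau> x (N x (?E x c)))"
    by (intro smooth_map_on_sum[OF vector_bundleD(1)[OF A] op]
        smooth_map_on_scaleR[OF vector_bundleD(1)[OF A] op]
        smooth_map_on_bilinear[OF vector_bundleD(1)[OF A] bounded_bilinear_inner op]
        smooth_map_on_const[OF vector_bundleD(1)[OF A]] X(2) bundle_endoD(3)[OF N U])
  then show ?thesis
  proof (rule smooth_map_on_cong[OF vector_bundleD(1)[OF A] op, rotated])
    fix x assume x: "x \<in> U"
    have "linear_on_set (fibre A x) (\<lambda>v. \<tau> x (N x v))"
      using vector_bundleD(5)[OF A U x] bundle_endoD[OF N] by (simp add: linear_on_set_def)
    then show "(\<Sum>c\<in>C. (\<tau> x (X x) \<bullet> d c) *\<^sub>R \<tau> x (N x (?E x c))) = \<tau> x (N x (X x))"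
      using frame_expansion[OF C U x X(1)[OF x], of "\<lambda>v. \<tau> x (N x v)"] by simp
  qed
qed

lemma bundle_endo_sections:
  assumes "bundle_endo A N" "X \<in> sections A"
  shows "(\<lambda>x. N x (X x)) \<in> sections A"
  using smooth_endo_apply[OF assms(1)] bundle_endoD(1)[OF assms(1)] assms(2)
  by (auto simp: sections_def)

lemma bundle_endo_comp:
  assumes N: "bundle_endo A N" and M: "bundle_endo A M"
  shows "bundle_endo A (\<lambda>x v. N x (M x v))"
proof -
  have "smooth_map_on A U (\<lambda>x. \<tau> x (N x (M x (inv_into (fibre A x) (\<tau> x) a))))"
    if U: "(U, \<tau>) \<in> trivs A" for U \<tau> a
    by (intro smooth_endo_apply[OF N U] smooth_endo_apply[OF M U] bundle_endoD(1)[OF M]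
        vector_bundleD(6)[OF A U] smooth_frame[OF U])
  then show ?thesis
    using bundle_endoD[OF N] bundle_endoD[OF M]
    unfolding bundle_endo_def by (auto simp: linear_on_set_def)
qed

text \<open>Evaluating the alternating \<open>\<omega>\<close> at \<open>N v + v\<close> twice gives
  \<open>\<omega>(N v, v) + \<omega>(v, N v) = 0\<close>; by symmetry of \<open>N\<close> both
  summands are equal, so both vanish.\<close>

lemma two_form_endo:
  assumes \<omega>: "two_form A \<omega>" and N: "bundle_endo A N"
    and sym: "\<And>x v w. v \<in> fibre A x \<Longrightarrow> w \<in> fibre A x \<Longrightarrow> \<omega> x (N x v) w = \<omega> x v (N x w)"
  shows "two_form A (\<lambda>x v w. \<omega> x (N x v) w)"
proof -
  have lin: "linear_on_set (fibre A x) (\<omega> x v)" "linear_on_set (fibre A x) (\<lambda>u. \<omega> x u v)"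
      "\<omega> x v v = 0"
    if "v \<in> fibre A x" for x v
    using \<omega> that by (auto simp: two_form_def)
  have "\<omega> x (N x v) v = 0" if v: "v \<in> fibre A x" for x v
  proof -
    have Nv: "N x v \<in> fibre A x" using bundle_endoD(1)[OF N v] .
    then have s: "N x v + v \<in> fibre A x" using v vector_bundleD(2)[OF A] by (auto intro: subspace_add)
    have "0 = \<omega> x (N x v + v) (N x v + v)" using lin(3)[OF s] by simp
    also have "\<dots> = \<omega> x (N x v) (N x v) + \<omega> x (N x v) v + (\<omega> x v (N x v) + \<omega> x v v)"
      using linear_on_set_add[OF lin(2)[OF s] Nv v] linear_on_set_add[OF lin(1)[OF v] Nv v]
        linear_on_set_add[OF lin(1)[OF Nv] Nv v] by simp
    also have "\<dots> = 2 * \<omega> x (N x v) v" using lin(3) sym v Nv by simp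
    finally show ?thesis by simp
  qed
  moreover have "smooth_map_on A U (\<lambda>x. \<omega> x (N x (inv_into (fibre A x) (\<tau> x) a)) (inv_into (fibre A x) (\<tau> x) b))"
    if U: "(U, \<tau>) \<in> trivs A" for U \<tau> a b
  proof (rule smooth_two_form_apply[OF \<omega> U])
  qed (use bundle_endoD[OF N] vector_bundleD(6)[OF A U] smooth_frame[OF U] U in auto)
  ultimately show ?thesis
    using lin bundle_endoD[OF N] unfolding two_form_def
    by (auto simp: linear_on_set_def)
qed

text \<open>A section with constant coordinates in a trivialisation is multiplied by a bump function
  and extended by zero. It turns statements tested on sections into statements about single
  vectors.\<close>

lemma section_through:
  assumes "v \<in> fibre A x"
  obtains X where "X \<in> sections A" "X x = v"
proof -
  note M = vector_bundleD(1)[OF A]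
  obtain U \<tau> where U: "(U, \<tau>) \<in> trivs A" "x \<in> U" using vector_bundleD(3)[OF A] by blast
  obtain f K where f: "smooth_map_on A UNIV f" "f x = (1::real)" "closed K" "K \<subseteq> U"
    "\<And>y. y \<notin> K \<Longrightarrow> f y = 0"
    using smooth_bump[OF M vector_bundleD(4)[OF A U(1)] U(2)] by blast
  define e where "e y = inv_into (fibre A y) (\<tau> y) (\<tau> x v)" for y
  define X where "X y = (if y \<in> U then f y *\<^sub>R e y else 0)" for y
  have e: "e y \<in> fibre A y" if "y \<in> U" for y
    unfolding e_def by (rule vector_bundleD(6)[OF A U(1) that])
  \<comment> \<open>\<open>V\<close> is covered by the open sets \<open>U \<inter> V\<close>, where
    the transition function is smooth, and \<open>V - K\<close>, where \<open>X\<close>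
    vanishes.\<close>
  have "smooth_map_on A V (\<lambda>y. \<sigma> y (X y))" if V: "(V, \<sigma>) \<in> trivs A" for V \<sigma>
  proof -
    note op = vector_bundleD(4)[OF A U(1)] vector_bundleD(4)[OF A V]
    have "smooth_map_on A (U \<inter> V) (\<lambda>y. f y *\<^sub>R \<sigma> y (e y))"
      unfolding e_def using op vector_bundleD(9)[OF A U(1) V]
      by (intro smooth_map_on_scaleR[OF M] smooth_map_on_subset[OF M f(1)]) auto
    then have "smooth_map_on A (U \<inter> V) (\<lambda>y. \<sigma> y (X y))"
      by (rule smooth_map_on_cong[OF M, rotated 2])
         (use op linear_on_set_scale[OF vector_bundleD(5)[OF A V]] e in \<open>auto simp: X_def\<close>)
    moreover have "smooth_map_on A (V - K) (\<lambda>y. \<sigma> y (X y))"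
      by (rule smooth_map_on_cong[OF M _ _ smooth_map_on_const[OF M, of _ 0]])
         (use op f in \<open>auto simp: X_def
            linear_on_set_0[OF vector_bundleD(5)[OF A V] vector_bundleD(2)[OF A]]\<close>)
    ultimately have "smooth_map_on A (\<Union>{U \<inter> V, V - K}) (\<lambda>y. \<sigma> y (X y))"
      using op f(3) by (intro smooth_map_on_Union[OF M]) auto
    moreover have "\<Union>{U \<inter> V, V - K} = V" using f(4) by auto
    ultimately show ?thesis by simp
  qed
  then have "X \<in> sections A"
    using e vector_bundleD(2)[OF A] by (auto simp: sections_def X_def subspace_scale subspace_0)
  moreover have "X x = v"
    using U f(2) vector_bundleD(8)[OF A U assms] by (simp add: X_def e_def)
  ultimately show thesis using that by blast
qed

section \<open>Covectors, bivectors and the maps \<open>sharp\<close> and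
  \<open>flat\<close>\<close>

lemma dual_fibre_sum:
  assumes "\<And>i. i \<in> I \<Longrightarrow> \<beta> i \<in> dual_fibre A x"
  shows "(\<lambda>v. \<Sum>i\<in>I. t i * \<beta> i v) \<in> dual_fibre A x"
proof -
  have "\<beta> i v = 0" if "i \<in> I" "v \<notin> fibre A x" for i v
  proof -
    have "covec A x (\<beta> i) v = \<beta> i v" using assms[OF that(1)] by (simp add: dual_fibre_def)
    then show ?thesis using that(2) by (simp add: covec_def)
  qed
  then have "covec A x (\<lambda>v. \<Sum>i\<in>I. t i * \<beta> i v) = (\<lambda>v. \<Sum>i\<in>I. t i * \<beta> i v)"
    by (auto simp: covec_def fun_eq_iff intro!: sum.neutral)
  moreover have "linear_on_set (fibre A x) (\<lambda>v. \<Sum>i\<in>I. t i * \<beta> i v)"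
    using assms
    by (auto simp: dual_fibre_def linear_on_set_def sum.distrib[symmetric] distrib_left
        sum_distrib_left mult.left_commute intro!: sum.cong)
  ultimately show ?thesis by (simp add: dual_fibre_def)
qed

lemma bivector_sum:
  assumes \<pi>: "bivector A \<pi>" and I: "finite I" "\<And>i. i \<in> I \<Longrightarrow> \<beta> i \<in> dual_fibre A x"
    and \<gamma>: "\<gamma> \<in> dual_fibre A x"
  shows "\<pi> x (\<lambda>v. \<Sum>i\<in>I. t i * \<beta> i v) \<gamma> = (\<Sum>i\<in>I. t i * \<pi> x (\<beta> i) \<gamma>)"
    and "\<pi> x \<gamma> (\<lambda>v. \<Sum>i\<in>I. t i * \<beta> i v) = (\<Sum>i\<in>I. t i * \<pi> x \<gamma> (\<beta> i))"
proof -
  have add: "\<pi> x (\<lambda>v. \<alpha> v + \<beta> v) \<gamma> = \<pi> x \<alpha> \<gamma> + \<pi> x \<beta> \<gamma>"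
        "\<pi> x \<gamma> (\<lambda>v. \<alpha> v + \<beta> v) = \<pi> x \<gamma> \<alpha> + \<pi> x \<gamma> \<beta>"
    if "\<alpha> \<in> dual_fibre A x" "\<beta> \<in> dual_fibre A x" for \<alpha> \<beta>
    using \<pi> \<gamma> that unfolding bivector_def by blast+
  have scale: "\<pi> x (\<lambda>v. c * \<alpha> v) \<gamma> = c * \<pi> x \<alpha> \<gamma>" "\<pi> x \<gamma> (\<lambda>v. c * \<alpha> v) = c * \<pi> x \<gamma> \<alpha>"
    if "\<alpha> \<in> dual_fibre A x" for \<alpha> c
    using \<pi> \<gamma> that unfolding bivector_def by blast+
  have 0: "\<pi> x (\<lambda>v. 0) \<gamma> = 0" "\<pi> x \<gamma> (\<lambda>v. 0) = 0"
    using scale[OF \<gamma>, of 0] by simp_all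
  have sc: "(\<lambda>v. c * \<beta> v) \<in> dual_fibre A x" if "\<beta> \<in> dual_fibre A x" for \<beta> c
    using dual_fibre_sum[of "{0::nat}" "\<lambda>_. \<beta>" x "\<lambda>_. c"] that by simp
  show "\<pi> x (\<lambda>v. \<Sum>i\<in>I. t i * \<beta> i v) \<gamma> = (\<Sum>i\<in>I. t i * \<pi> x (\<beta> i) \<gamma>)"
    and "\<pi> x \<gamma> (\<lambda>v. \<Sum>i\<in>I. t i * \<beta> i v) = (\<Sum>i\<in>I. t i * \<pi> x \<gamma> (\<beta> i))"
    using I by (induction I) (simp_all add: 0 add scale sc dual_fibre_sum)
qed

lemma coframe_dual:
  assumes "(U, \<tau>) \<in> trivs A" "x \<in> U"
  shows "covec A x (\<lambda>v. \<tau> x v \<bullet> u) \<in> dual_fibre A x"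
  using vector_bundleD(5)[OF A assms]
  by (intro covec_in_dual_fibre vector_bundleD(2)[OF A]) (simp add: linear_on_set_def inner_add_left)

lemma flat_dual:
  assumes "two_form A \<omega>" "v \<in> fibre A x"
  shows "flat A \<omega> x v \<in> dual_fibre A x"
  unfolding flat_def using assms vector_bundleD(2)[OF A]
  by (intro covec_in_dual_fibre) (auto simp: two_form_def)

text \<open>Frame expansion applied to \<open>\<beta>\<close> itself. Off the fibre both sides are 0
  by the convention of \<open>covec\<close>, so the equality is one of functions.\<close>

lemma coframe_expansion:
  assumes C: "\<And>u. u = (\<Sum>c\<in>C. (u \<bullet> d c) *\<^sub>R c)"
    and U: "(U, \<tau>) \<in> trivs A" "x \<in> U" and \<beta>: "\<beta> \<in> dual_fibre A x"
  shows "\<beta> = (\<lambda>v. \<Sum>c\<in>C. \<beta> (inv_into (fibre A x) (\<tau> x) c) * covec A x (\<lambda>v. \<tau> x v \<bullet> d c) v)"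
proof
  fix v
  show "\<beta> v = (\<Sum>c\<in>C. \<beta> (inv_into (fibre A x) (\<tau> x) c) * covec A x (\<lambda>v. \<tau> x v \<bullet> d c) v)"
  proof (cases "v \<in> fibre A x")
    case True
    then show ?thesis
      using frame_expansion[OF C U True, of \<beta>] \<beta> by (simp add: dual_fibre_def covec_def mult.commute)
  next
    case False
    have "covec A x \<beta> v = \<beta> v" using \<beta> by (simp add: dual_fibre_def)
    then show ?thesis using False by (simp add: covec_def)
  qed
qed

text \<open>Inner products with all \<open>u\<close> determine \<open>\<tau> x v\<close>, so the
  coordinate covectors suffice. This gives the uniqueness behind the definite description in
  \<open>sharp\<close>.\<close>

lemma dual_fibre_separates:
  assumes "v \<in> fibre A x" "w \<in> fibre A x" "\<And>\<beta>. \<beta> \<in> dual_fibre A x \<Longrightarrow> \<beta> v = \<beta> w"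
  shows "v = w"
proof -
  obtain U \<tau> where U: "(U, \<tau>) \<in> trivs A" "x \<in> U" using vector_bundleD(3)[OF A] by blast
  have "\<tau> x v \<bullet> u = \<tau> x w \<bullet> u" for u
    using assms(3)[OF coframe_dual[OF U, of u]] assms(1,2) by (simp add: covec_def)
  then have "\<tau> x v = \<tau> x w" by (metis inner_commute vector_eq_rdot)
  then show ?thesis using vector_bundleD(8)[OF A U] assms(1,2) by metis
qed

lemma sharp_spec:
  assumes \<pi>: "bivector A \<pi>" and \<alpha>: "\<alpha> \<in> dual_fibre A x"
  shows "sharp A \<pi> x \<alpha> \<in> fibre A x" "\<beta> \<in> dual_fibre A x \<Longrightarrow> \<beta> (sharp A \<pi> x \<alpha>) = \<pi> x \<alpha> \<beta>"
proof -
  obtain U \<tau> where U: "(U, \<tau>) \<in> trivs A" "x \<in> U" using vector_bundleD(3)[OF A] by blast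
  let ?E = "inv_into (fibre A x) (\<tau> x)"
  obtain C :: "'k set" and d where C: "finite C" "\<And>u. u = (\<Sum>c\<in>C. (u \<bullet> d c) *\<^sub>R c)"
    by (rule fibre_type_expansion) (rule that)
  \<comment> \<open>The contraction of \<open>\<pi>\<close> with \<open>\<alpha>\<close>, written in
    the frame; expanding \<open>\<beta>\<close> in the coframe shows that it satisfies the
    description of \<open>sharp\<close>.\<close>
  define v where "v = (\<Sum>c\<in>C. \<pi> x \<alpha> (covec A x (\<lambda>v. \<tau> x v \<bullet> d c)) *\<^sub>R ?E c)"
  have v: "v \<in> fibre A x" unfolding v_def
    by (intro subspace_sum subspace_scale vector_bundleD(2)[OF A] vector_bundleD(6)[OF A U])
  have "\<beta> v = \<pi> x \<alpha> \<beta>" if \<beta>: "\<beta> \<in> dual_fibre A x" for \<beta>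
  proof -
    have "\<beta> v = (\<Sum>c\<in>C. \<pi> x \<alpha> (covec A x (\<lambda>v. \<tau> x v \<bullet> d c)) *\<^sub>R \<beta> (?E c))"
      unfolding v_def using \<beta>
      by (intro linear_on_set_sum[of "fibre A x"] vector_bundleD(2)[OF A] vector_bundleD(6)[OF A U])
         (simp add: dual_fibre_def)
    also have "\<dots> = \<pi> x \<alpha> (\<lambda>v. \<Sum>c\<in>C. \<beta> (?E c) * covec A x (\<lambda>v. \<tau> x v \<bullet> d c) v)"
      using bivector_sum(2)[OF \<pi> C(1) coframe_dual[OF U] \<alpha>] by (simp add: mult.commute)
    also have "\<dots> = \<pi> x \<alpha> \<beta>" using coframe_expansion[OF C(2) U \<beta>] by simp
    finally show ?thesis .
  qed
  then have "\<exists>!v. v \<in> fibre A x \<and> (\<forall>\<beta>\<in>dual_fibre A x. \<beta> v = \<pi> x \<alpha> \<beta>)"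
    using v dual_fibre_separates by (intro ex1I[of _ v]) auto
  from theI'[OF this]
  show "sharp A \<pi> x \<alpha> \<in> fibre A x" "\<beta> \<in> dual_fibre A x \<Longrightarrow> \<beta> (sharp A \<pi> x \<alpha>) = \<pi> x \<alpha> \<beta>"
    unfolding sharp_def by blast+
qed

lemma bundle_endo_sharp_flat:
  assumes \<pi>: "bivector A \<pi>" and \<omega>: "two_form A \<omega>"
  shows "bundle_endo A (\<lambda>x v. sharp A \<pi> x (flat A \<omega> x v))"
  unfolding bundle_endo_def
proof (intro conjI allI ballI, goal_cases)
  case (1 x)
  then show ?case using sharp_spec(1)[OF \<pi> flat_dual[OF \<omega>]] by blast
next
  case (2 x)
  let ?N = "\<lambda>v. sharp A \<pi> x (flat A \<omega> x v)"
  note F = flat_dual[OF \<omega>] and S = sharp_spec[OF \<pi> flat_dual[OF \<omega>]]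
  have sub: "subspace (fibre A x)" by (rule vector_bundleD(2)[OF A])
  \<comment> \<open>The combination is written as a sum over the two booleans so that
    \<open>bivector_sum\<close> applies to it.\<close>
  have fl: "flat A \<omega> x (s *\<^sub>R u + t *\<^sub>R v) = (\<lambda>w. \<Sum>i\<in>{True, False}. (if i then s else t) *
      (if i then flat A \<omega> x u else flat A \<omega> x v) w)"
    if uv: "u \<in> fibre A x" "v \<in> fibre A x" for u v s t
  proof -
    have "\<omega> x (s *\<^sub>R u + t *\<^sub>R v) w = s * \<omega> x u w + t * \<omega> x v w" if "w \<in> fibre A x" for w
    proof -
      have l: "linear_on_set (fibre A x) (\<lambda>u. \<omega> x u w)" using \<omega> that by (simp add: two_form_def)
      show ?thesis
        using linear_on_set_add[OF l, of "s *\<^sub>R u" "t *\<^sub>R v"] linear_on_set_scale[OF l] uv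
          subspace_scale[OF sub] by simp
    qed
    then show ?thesis by (auto simp: flat_def covec_def)
  qed
  have "?N (s *\<^sub>R u + t *\<^sub>R v) = s *\<^sub>R ?N u + t *\<^sub>R ?N v" if uv: "u \<in> fibre A x" "v \<in> fibre A x" for u v s t
  proof (rule dual_fibre_separates)
    have w: "s *\<^sub>R u + t *\<^sub>R v \<in> fibre A x"
      using uv sub by (auto intro: subspace_add subspace_scale)
    then show "?N (s *\<^sub>R u + t *\<^sub>R v) \<in> fibre A x" by (rule S(1))
    show "s *\<^sub>R ?N u + t *\<^sub>R ?N v \<in> fibre A x"
      using S(1) uv sub by (auto intro: subspace_add subspace_scale)
    fix \<beta> assume \<beta>: "\<beta> \<in> dual_fibre A x"
    then have l: "linear_on_set (fibre A x) \<beta>" by (simp add: dual_fibre_def)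
    have "\<beta> (?N (s *\<^sub>R u + t *\<^sub>R v)) = s * \<pi> x (flat A \<omega> x u) \<beta> + t * \<pi> x (flat A \<omega> x v) \<beta>"
      unfolding S(2)[OF w \<beta>] unfolding fl[OF uv]
      using F uv by (subst bivector_sum(1)[OF \<pi> _ _ \<beta>]) auto
    also have "\<dots> = \<beta> (s *\<^sub>R ?N u + t *\<^sub>R ?N v)"
      using linear_on_set_add[OF l, of "s *\<^sub>R ?N u" "t *\<^sub>R ?N v"] linear_on_set_scale[OF l] S uv \<beta>
        subspace_scale[OF sub] by simp
    finally show "\<beta> (?N (s *\<^sub>R u + t *\<^sub>R v)) = \<beta> (s *\<^sub>R ?N u + t *\<^sub>R ?N v)" .
  qed
  \<comment> \<open>Coefficients \<open>s = t = 1\<close> give additivity, and \<open>t = 0\<close>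
    gives homogeneity.\<close>
  from this[of _ _ 1 1] this[where t = 0] show ?case
    by (auto simp: linear_on_set_def)
next
  case (3 U\<tau>)
  obtain U \<tau> where U\<tau>: "U\<tau> = (U, \<tau>)" by fastforce
  with 3 have U: "(U, \<tau>) \<in> trivs A" by simp
  note M = vector_bundleD(1)[OF A] and op = vector_bundleD(4)[OF A U]
  let ?E = "\<lambda>x. inv_into (fibre A x) (\<tau> x)"
  obtain C :: "'k set" and d where C: "finite C" "\<And>u. u = (\<Sum>c\<in>C. (u \<bullet> d c) *\<^sub>R c)"
    by (rule fibre_type_expansion) (rule that)
  let ?\<theta> = "\<lambda>x c. covec A x (\<lambda>v. \<tau> x v \<bullet> d c)"
  have "smooth_map_on A U (\<lambda>x. \<tau> x (sharp A \<pi> x (flat A \<omega> x (?E x a))))" for a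
  proof -
    have "linear (\<lambda>u. u \<bullet> d c)" for c
      by (rule bounded_linear.linear[OF bounded_linear_inner_left])
    then have \<pi>s: "smooth_map_on A U (\<lambda>x. \<pi> x (?\<theta> x c) (?\<theta> x e))" for c e
      using \<pi> U unfolding bivector_def by blast
    have "smooth_map_on A U (\<lambda>x. \<omega> x (?E x a) (?E x c))" for c
      using \<omega> U unfolding two_form_def by blast
    \<comment> \<open>The coordinates of the image vector are the matrix product of the components
      of \<open>\<omega>\<close> and of \<open>\<pi>\<close>, hence smooth.\<close>
    with \<pi>s have "smooth_map_on A U (\<lambda>x. \<Sum>c\<in>C. (\<Sum>e\<in>C. \<omega> x (?E x a) (?E x e) * \<pi> x (?\<theta> x e) (?\<theta> x c)) *\<^sub>R c)"
      by (intro smooth_map_on_sum[OF M op] smooth_map_on_scaleR[OF M op] smooth_map_on_mult[OF M op]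
          smooth_map_on_const[OF M])
    then show ?thesis
    proof (rule smooth_map_on_cong[OF M op, rotated])
      fix x assume x: "x \<in> U"
      let ?v = "sharp A \<pi> x (flat A \<omega> x (?E x a))"
      have E: "?E x u \<in> fibre A x" for u by (rule vector_bundleD(6)[OF A U x])
      note F = flat_dual[OF \<omega> E]
      have "\<tau> x ?v \<bullet> d c = (\<Sum>e\<in>C. \<omega> x (?E x a) (?E x e) * \<pi> x (?\<theta> x e) (?\<theta> x c))" for c
      proof -
        have "\<tau> x ?v \<bullet> d c = ?\<theta> x c ?v"
          using sharp_spec(1)[OF \<pi> F] by (simp add: covec_def)
        also have "\<dots> = \<pi> x (flat A \<omega> x (?E x a)) (?\<theta> x c)"
          by (rule sharp_spec(2)[OF \<pi> F coframe_dual[OF U x]])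
        also have "\<dots> = \<pi> x (\<lambda>v. \<Sum>e\<in>C. flat A \<omega> x (?E x a) (?E x e) * ?\<theta> x e v) (?\<theta> x c)"
          using coframe_expansion[OF C(2) U x F, of a] by simp
        also have "\<dots> = (\<Sum>e\<in>C. flat A \<omega> x (?E x a) (?E x e) * \<pi> x (?\<theta> x e) (?\<theta> x c))"
          by (rule bivector_sum(1)[OF \<pi> C(1) coframe_dual[OF U x] coframe_dual[OF U x]])
        finally show ?thesis using E by (simp add: flat_def covec_def)
      qed
      then show "(\<Sum>c\<in>C. (\<Sum>e\<in>C. \<omega> x (?E x a) (?E x e) * \<pi> x (?\<theta> x e) (?\<theta> x c)) *\<^sub>R c) = \<tau> x ?v"
        using C(2)[of "\<tau> x ?v"] by simp
    qed
  qed
  then show ?case by (simp add: U\<tau>)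
qed

end

section \<open>Closed forms and torsion on Lie algebroids\<close>

text \<open>The condition that \<open>flat A \<omega>\<close> intertwines \<open>N\<close> with its
  transpose, evaluated on pairs of vectors.\<close>

definition endo_symmetric ::
  "('m, 'e, 'v, 'k, 'z) bundle_data_scheme \<Rightarrow> ('m \<Rightarrow> 'v \<Rightarrow> 'v \<Rightarrow> real) \<Rightarrow> ('m \<Rightarrow> 'v \<Rightarrow> 'v) \<Rightarrow> bool" where
  "endo_symmetric A \<omega> N \<longleftrightarrow> (\<forall>x. \<forall>v\<in>fibre A x. \<forall>w\<in>fibre A x. \<omega> x (N x v) w = \<omega> x v (N x w))"

definition nondegenerate ::
  "('m, 'e, 'v::zero, 'k, 'z) bundle_data_scheme \<Rightarrow> ('m \<Rightarrow> 'v \<Rightarrow> 'v \<Rightarrow> real) \<Rightarrow> bool" where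
  "nondegenerate A \<omega> \<longleftrightarrow> (\<forall>x. \<forall>v\<in>fibre A x. (\<forall>w\<in>fibre A x. \<omega> x v w = 0) \<longrightarrow> v = 0)"

abbreviation (input) form_endo :: "('m \<Rightarrow> 'v \<Rightarrow> 'v \<Rightarrow> real) \<Rightarrow> ('m \<Rightarrow> 'v \<Rightarrow> 'v) \<Rightarrow> 'm \<Rightarrow> 'v \<Rightarrow> 'v \<Rightarrow> real" where
  "form_endo \<omega> N \<equiv> \<lambda>x v w. \<omega> x (N x v) w"

lemma two_formD:
  assumes "two_form A \<omega>" "v \<in> fibre A x"
  shows "linear_on_set (fibre A x) (\<omega> x v)" "linear_on_set (fibre A x) (\<lambda>u. \<omega> x u v)" "\<omega> x v v = 0"
  using assms by (auto simp: two_form_def)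

lemma two_form_skew:
  assumes "two_form A \<omega>" "subspace (fibre A x)" "v \<in> fibre A x" "w \<in> fibre A x"
  shows "\<omega> x v w = - \<omega> x w v"
proof -
  have s: "v + w \<in> fibre A x" using assms by (simp add: subspace_add)
  have "0 = \<omega> x (v + w) (v + w)" using two_formD(3)[OF assms(1) s] by simp
  also have "\<dots> = \<omega> x v v + \<omega> x v w + (\<omega> x w v + \<omega> x w w)"
    using linear_on_set_add[OF two_formD(2)[OF assms(1) s] assms(3,4)]
      linear_on_set_add[OF two_formD(1)[OF assms(1,3)] assms(3,4)]
      linear_on_set_add[OF two_formD(1)[OF assms(1,4)] assms(3,4)] by simp
  finally show ?thesis using two_formD(3)[OF assms(1)] assms(3,4) by simp
qed

context
  fixes A :: "('m::{t2_space,second_countable_topology}, 'e::real_inner, 'v::real_vector,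
               'k::real_inner, 'z) lie_algebroid_data_scheme"
  assumes A: "lie_algebroid A"
begin

lemma lie_algebroidD:
  shows "vector_bundle A" "subspace (fibre A x)"
    and "X \<in> sections A \<Longrightarrow> X x \<in> fibre A x"
    and "X \<in> sections A \<Longrightarrow> Y \<in> sections A \<Longrightarrow> bracket A X Y \<in> sections A"
    and "X \<in> sections A \<Longrightarrow> Y \<in> sections A \<Longrightarrow> bracket A X Y x \<in> fibre A x"
proof -
  show V: "vector_bundle A" using A by (simp add: lie_algebroid_def)
  show "subspace (fibre A x)" by (rule vector_bundleD(2)[OF V])
  show *: "X \<in> sections A \<Longrightarrow> X x \<in> fibre A x" for X by (rule sectionsD[OF V])
  show "X \<in> sections A \<Longrightarrow> Y \<in> sections A \<Longrightarrow> bracket A X Y \<in> sections A"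
    using A unfolding lie_algebroid_def by blast
  then show "X \<in> sections A \<Longrightarrow> Y \<in> sections A \<Longrightarrow> bracket A X Y x \<in> fibre A x"
    by (simp add: *)
qed

text \<open>The Cartan formula evaluates a form on fibre vectors only, so its values elsewhere are
  irrelevant.\<close>

lemma closed_form_cong:
  assumes "\<And>x v w. v \<in> fibre A x \<Longrightarrow> w \<in> fibre A x \<Longrightarrow> \<omega> x v w = \<eta> x v w" "closed_form A \<omega>"
  shows "closed_form A \<eta>"
  using assms unfolding closed_form_def differential_def
  by (simp add: lie_algebroidD)

text \<open>Tangent vectors are homogeneous on smooth functions only; that \<open>\<omega>\<close>
  is a smooth 2-form makes \<open>\<omega>(Y, Z)\<close> such a function.\<close>

lemma closed_form_scale:
  assumes "two_form A \<omega>" "closed_form A \<omega>"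
  shows "closed_form A (\<lambda>x v w. c * \<omega> x v w)"
proof -
  have "anchor A x v (\<lambda>y. c * f y) = c * anchor A x v f"
    if "v \<in> fibre A x" "f \<in> smooth_functions A" for x v f
  proof -
    have "tangent_vector A x (anchor A x v)" using A that(1) by (simp add: lie_algebroid_def)
    then show ?thesis using that(2) by (simp add: tangent_vector_def)
  qed
  then have "anchor_deriv A X (\<lambda>y. c * \<omega> y (Y y) (Z y)) x
      = c * anchor_deriv A X (\<lambda>y. \<omega> y (Y y) (Z y)) x"
    if "X \<in> sections A" "Y \<in> sections A" "Z \<in> sections A" for X Y Z x
    using that two_form_sections_smooth[OF lie_algebroidD(1) assms(1)] lie_algebroidD(3)
    by (simp add: anchor_deriv_def)
  then have "differential A (\<lambda>x v w. c * \<omega> x v w) X Y Z = (\<lambda>x. c * differential A \<omega> X Y Z x)"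
    if "X \<in> sections A" "Y \<in> sections A" "Z \<in> sections A" for X Y Z
    using that by (simp add: differential_def algebra_simps)
  then show ?thesis using assms(2) by (simp add: closed_form_def)
qed

section \<open>Torsion and closedness\<close>

lemma nijenhuis_torsion_0I:
  assumes \<omega>: "two_form A \<omega>" "nondegenerate A \<omega>" and N: "bundle_endo A N"
    and sym: "endo_symmetric A \<omega> N"
    and cl: "closed_form A \<omega>" "closed_form A (form_endo \<omega> N)"
      "closed_form A (form_endo \<omega> (\<lambda>x v. N x (N x v)))"
    and X: "X \<in> sections A" and Y: "Y \<in> sections A"
  shows "nijenhuis_torsion A N X Y = (\<lambda>x. 0)"
proof
  fix x
  note V = lie_algebroidD(1)
  let ?NX = "\<lambda>x. N x (X x)" and ?NY = "\<lambda>x. N x (Y x)"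
  have NX: "?NX \<in> sections A" and NY: "?NY \<in> sections A"
    using bundle_endo_sections[OF V N] X Y by auto
  note br = lie_algebroidD(5)
  note Nf = bundle_endoD(1)[OF V N] and Nl = bundle_endoD(2)[OF V N]
  let ?a = "bracket A ?NX ?NY x" and ?b = "bracket A ?NX Y x" and ?c = "bracket A X ?NY x"
    and ?d = "bracket A X Y x"
  let ?T = "nijenhuis_torsion A N X Y x"
  have f: "?a \<in> fibre A x" "?b \<in> fibre A x" "?c \<in> fibre A x" "?d \<in> fibre A x"
    using br NX NY X Y by auto
  have T: "?T = ?a - N x (?b + ?c - N x ?d)" by (simp add: nijenhuis_torsion_def Let_def)
  have Tf: "?T \<in> fibre A x"
    unfolding T by (intro subspace_diff subspace_add Nf lie_algebroidD(2) f)
  have "\<omega> x ?T w = 0" if w: "w \<in> fibre A x" for w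
  proof -
    \<comment> \<open>The differential takes sections, so the test vector \<open>w\<close> has to be
      extended to one.\<close>
    obtain Z where Z: "Z \<in> sections A" "Z x = w" by (rule section_through[OF V w])
    \<comment> \<open>Symmetry is needed at all points \<open>y\<close>: the anchor differentiates
      functions such as \<open>\<omega>(N X, Y)\<close>, which have to agree as functions.\<close>
    have s: "\<omega> y (N y v) u = \<omega> y v (N y u)" if "v \<in> fibre A y" "u \<in> fibre A y" for y v u
      using sym that by (simp add: endo_symmetric_def)
    have lw: "linear_on_set (fibre A x) (\<lambda>u. \<omega> x u w)" by (rule two_formD(2)[OF \<omega>(1) w])
    have "\<omega> x ?T w = \<omega> x ?a w - (\<omega> x (N x ?b) w + \<omega> x (N x ?c) w - \<omega> x (N x (N x ?d)) w)"
      unfolding T using f Nf lie_algebroidD(2)[of x]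
      by (simp add: linear_on_set_diff[OF lw] linear_on_set_add[OF lw] linear_on_set_diff[OF Nl]
          linear_on_set_add[OF Nl] subspace_diff subspace_add)
    \<comment> \<open>Once \<open>N\<close> is moved to the second argument, the anchor terms and
      the brackets with \<open>Z\<close> cancel in pairs, leaving only the brackets of the
      torsion.\<close>
    moreover have "differential A \<omega> ?NX ?NY Z x - differential A (form_endo \<omega> N) ?NX Y Z x
        - differential A (form_endo \<omega> N) X ?NY Z x
        + differential A (form_endo \<omega> (\<lambda>x v. N x (N x v))) X Y Z x
      = - (\<omega> x ?a w - \<omega> x (N x ?b) w - \<omega> x (N x ?c) w + \<omega> x (N x (N x ?d)) w)"
      unfolding differential_def
      using s Nf lie_algebroidD(3) br NX NY X Y Z by (simp add: Z(2)[symmetric])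
    moreover have "differential A \<eta> X' Y' Z x = 0"
      if "closed_form A \<eta>" "X' \<in> sections A" "Y' \<in> sections A" for \<eta> X' Y'
      using that Z unfolding closed_form_def by simp
    ultimately show ?thesis using cl NX NY X Y by simp
  qed
  then show "?T = 0" using \<omega>(2) Tf by (auto simp: nondegenerate_def)
qed

lemma nijenhuis_torsion_0D:
  assumes N: "bundle_endo A N" and X: "X \<in> sections A" and Y: "Y \<in> sections A"
    and T: "nijenhuis_torsion A N X Y = (\<lambda>x. 0)"
  shows "bracket A (\<lambda>x. N x (X x)) (\<lambda>x. N x (Y x)) x =
    N x (bracket A (\<lambda>x. N x (X x)) Y x) + N x (bracket A X (\<lambda>x. N x (Y x)) x)
      - N x (N x (bracket A X Y x))"
proof -
  note V = lie_algebroidD(1)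
  have NX: "(\<lambda>x. N x (X x)) \<in> sections A" and NY: "(\<lambda>x. N x (Y x)) \<in> sections A"
    using bundle_endo_sections[OF V N] X Y by auto
  have f: "bracket A (\<lambda>x. N x (X x)) Y x \<in> fibre A x" "bracket A X (\<lambda>x. N x (Y x)) x \<in> fibre A x"
    "N x (bracket A X Y x) \<in> fibre A x"
    using lie_algebroidD(5) bundle_endoD(1)[OF V N] NX NY X Y by auto
  show ?thesis
    using fun_cong[OF T, of x] f lie_algebroidD(2)[of x]
    by (simp add: nijenhuis_torsion_def Let_def linear_on_set_diff[OF bundle_endoD(2)[OF V N]]
        linear_on_set_add[OF bundle_endoD(2)[OF V N]] subspace_add)
qed

text \<open>The torsions yield \<open>N M C = 0\<close>, the injectivity of \<open>N M\<close>
  removes that factor, and closedness of the three given forms turns \<open>C = 0\<close> into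
  closedness of the fourth.\<close>

lemma closed_form_endo_comp:
  assumes \<omega>: "two_form A \<omega>" and N: "bundle_endo A N" and M: "bundle_endo A M"
    and NM: "bundle_endo A (\<lambda>x v. N x (M x v))"
    and comm: "\<And>x v. v \<in> fibre A x \<Longrightarrow> M x (N x v) = N x (M x v)"
    and inj: "\<And>x v. v \<in> fibre A x \<Longrightarrow> N x (M x v) = 0 \<Longrightarrow> v = 0"
    and sym: "endo_symmetric A \<omega> N" "endo_symmetric A \<omega> M"
    and cl: "closed_form A \<omega>" "closed_form A (form_endo \<omega> N)" "closed_form A (form_endo \<omega> M)"
    and T: "\<And>X Y. X \<in> sections A \<Longrightarrow> Y \<in> sections A \<Longrightarrow> nijenhuis_torsion A N X Y = (\<lambda>x. 0)"
      "\<And>X Y. X \<in> sections A \<Longrightarrow> Y \<in> sections A \<Longrightarrow> nijenhuis_torsion A M X Y = (\<lambda>x. 0)"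
      "\<And>X Y. X \<in> sections A \<Longrightarrow> Y \<in> sections A \<Longrightarrow>
         nijenhuis_torsion A (\<lambda>x v. N x (M x v)) X Y = (\<lambda>x. 0)"
  shows "closed_form A (form_endo \<omega> (\<lambda>x v. N x (M x v)))"
  unfolding closed_form_def
proof (intro ballI ext)
  fix X Y Z x
  assume X: "X \<in> sections A" and Y: "Y \<in> sections A" and Z: "Z \<in> sections A"
  note V = lie_algebroidD(1)
  let ?n = "\<lambda>X x. N x (X x)" and ?m = "\<lambda>X x. M x (X x)"
  let ?B = "\<lambda>X Y. bracket A X Y x"
  note secN = bundle_endo_sections[OF V N] and secM = bundle_endo_sections[OF V M]
  note Nf = bundle_endoD(1)[OF V N] and Nl = bundle_endoD(2)[OF V N]
  note Mf = bundle_endoD(1)[OF V M] and Ml = bundle_endoD(2)[OF V M]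
  note br = lie_algebroidD(5)
  note sub = lie_algebroidD(2)[of x]
  note S = X Y secN[OF X] secN[OF Y] secM[OF X] secM[OF Y] secN[OF secM[OF X]] secN[OF secM[OF Y]]
  \<comment> \<open>Brackets depend on whole sections, so commutation is recorded as an equality of
    sections, not only at \<open>x\<close>.\<close>
  have mn: "?m (?n X) = ?n (?m X)" "?m (?n Y) = ?n (?m Y)"
    using comm lie_algebroidD(3) X Y by auto
  \<comment> \<open>The coefficient of \<open>t\<close> in the torsion of \<open>N + t M\<close>,
    using that \<open>N\<close> and \<open>M\<close> commute.\<close>
  let ?C = "?B (?n X) (?m Y) + ?B (?m X) (?n Y) - M x (?B (?n X) Y) - M x (?B X (?n Y))
    - N x (?B (?m X) Y) - N x (?B X (?m Y)) + 2 *\<^sub>R N x (M x (?B X Y))"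
  have fib: "?B X' Y' \<in> fibre A x" "M x (?B X' Y') \<in> fibre A x" "N x (?B X' Y') \<in> fibre A x"
    "N x (M x (?B X' Y')) \<in> fibre A x"
    if "X' \<in> sections A" "Y' \<in> sections A" for X' Y'
    using br that Nf Mf by auto
  note closure = subspace_add[OF sub] subspace_diff[OF sub] subspace_scale[OF sub]
  note lins = linear_on_set_diff[OF Nl sub] linear_on_set_add[OF Nl] linear_on_set_scale[OF Nl]
    linear_on_set_diff[OF Ml sub] linear_on_set_add[OF Ml] linear_on_set_scale[OF Ml]
  have Cf: "?C \<in> fibre A x" by (intro closure fib S)
  note TN = nijenhuis_torsion_0D[OF N _ _ T(1), where x = x]
    and TM = nijenhuis_torsion_0D[OF M _ _ T(2), where x = x]
    and TP = nijenhuis_torsion_0D[OF NM _ _ T(3), where x = x]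
  text \<open>
    Expanding \<open>[NMX, NMY]\<close> with the torsion of \<open>N\<close> at \<open>(MX, MY)\<close> and then that of \<open>M\<close> at
    \<open>(NX, Y)\<close>, \<open>(X, NY)\<close> and \<open>(X, Y)\<close>, and comparing with the torsion of \<open>N M\<close> at \<open>(X, Y)\<close>,
    leaves exactly this term.
  \<close>
  have "N x (M x ?C) = 0"
  proof -
    have "?B (?n (?m X)) (?n (?m Y)) = N x (?B (?n (?m X)) (?m Y)) + N x (?B (?m X) (?n (?m Y)))
        - N x (N x (?B (?m X) (?m Y)))"
      by (rule TN) (use S in auto)
    moreover have "?B (?n (?m X)) (?n (?m Y)) =
        N x (M x (?B (?n (?m X)) Y)) + N x (M x (?B X (?n (?m Y))))
        - N x (M x (N x (M x (?B X Y))))"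
      by (rule TP) (use S in auto)
    moreover have "?B (?m X) (?m Y) = M x (?B (?m X) Y) + M x (?B X (?m Y)) - M x (M x (?B X Y))"
      by (rule TM) (use S in auto)
    moreover have "?B (?n (?m X)) (?m Y) =
        M x (?B (?n (?m X)) Y) + M x (?B (?n X) (?m Y)) - M x (M x (?B (?n X) Y))"
      using TM[of "?n X" Y] S unfolding mn by simp
    moreover have "?B (?m X) (?n (?m Y)) =
        M x (?B (?m X) (?n Y)) + M x (?B X (?n (?m Y))) - M x (M x (?B X (?n Y)))"
      using TM[of X "?n Y"] S unfolding mn by simp
    moreover have "M x (N x (M x (?B X Y))) = N x (M x (M x (?B X Y)))"
      by (rule comm) (intro fib S)
    ultimately show ?thesis
      using S by (simp add: lins fib Nf Mf closure comm algebra_simps scaleR_2)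
  qed
  then have C: "?C = 0" by (rule inj[OF Cf])
  have s: "\<omega> y (N y v) u = \<omega> y v (N y u)" "\<omega> y (M y v) u = \<omega> y v (M y u)"
    if "v \<in> fibre A y" "u \<in> fibre A y" for y v u
    using sym that by (auto simp: endo_symmetric_def)
  let ?z = "Z x"
  have z: "?z \<in> fibre A x" by (rule lie_algebroidD(3)[OF Z])
  note lz = two_formD(2)[OF \<omega> z]
  have "\<omega> x ?C ?z = \<omega> x (?B (?n X) (?m Y)) ?z + \<omega> x (?B (?m X) (?n Y)) ?z - \<omega> x (M x (?B (?n X) Y)) ?z
      - \<omega> x (M x (?B X (?n Y))) ?z - \<omega> x (N x (?B (?m X) Y)) ?z - \<omega> x (N x (?B X (?m Y))) ?z
      + 2 * \<omega> x (N x (M x (?B X Y))) ?z"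
    using S by (simp add: fib closure linear_on_set_diff[OF lz sub] linear_on_set_add[OF lz]
        linear_on_set_scale[OF lz])
  moreover have "\<omega> x ?C ?z = 0"
    unfolding C using linear_on_set_0[OF lz sub] .
  \<comment> \<open>Likewise the coefficient of \<open>t\<close> in the identity of
    \<open>nijenhuis_torsion_0I\<close> for \<open>N + t M\<close>. On the left every differential
    except the last vanishes by hypothesis.\<close>
  moreover have "differential A \<omega> (?n X) (?m Y) Z x + differential A \<omega> (?m X) (?n Y) Z x
      - differential A (form_endo \<omega> N) (?m X) Y Z x - differential A (form_endo \<omega> N) X (?m Y) Z x
      - differential A (form_endo \<omega> M) (?n X) Y Z x - differential A (form_endo \<omega> M) X (?n Y) Z x
      + 2 * differential A (form_endo \<omega> (\<lambda>x v. N x (M x v))) X Y Z x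
    = - (\<omega> x (?B (?n X) (?m Y)) ?z + \<omega> x (?B (?m X) (?n Y)) ?z - \<omega> x (M x (?B (?n X) Y)) ?z
      - \<omega> x (M x (?B X (?n Y))) ?z - \<omega> x (N x (?B (?m X) Y)) ?z - \<omega> x (N x (?B X (?m Y))) ?z
      + 2 * \<omega> x (N x (M x (?B X Y))) ?z)"
    unfolding differential_def
    using S Z by (simp add: s Nf Mf lie_algebroidD(3) br comm)
  moreover have "differential A \<eta> X' Y' Z x = 0"
    if "closed_form A \<eta>" "X' \<in> sections A" "Y' \<in> sections A" for \<eta> X' Y'
    using that Z unfolding closed_form_def by simp
  ultimately show "differential A (form_endo \<omega> (\<lambda>x v. N x (M x v))) X Y Z x = 0"
    using cl S by simp
qed

section \<open>Constant multiples of forms, and assembling an \<Omega>N structure\<close>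

lemma closed_form_multiple:
  assumes "two_form A \<omega>" "closed_form A \<omega>"
    and "\<And>x v w. v \<in> fibre A x \<Longrightarrow> w \<in> fibre A x \<Longrightarrow> \<eta> x v w = c * \<omega> x v w"
  shows "closed_form A \<eta>"
  using closed_form_cong[OF _ closed_form_scale[OF assms(1,2)]] assms(3) by metis

lemma two_form_multiple:
  assumes \<omega>: "two_form A \<omega>"
    and \<eta>: "\<And>x v w. v \<in> fibre A x \<Longrightarrow> w \<in> fibre A x \<Longrightarrow> \<eta> x v w = c * \<omega> x v w"
  shows "two_form A \<eta>"
proof -
  note V = lie_algebroidD(1) and M = vector_bundleD(1)[OF lie_algebroidD(1)]
  have "smooth_map_on A U (\<lambda>x. \<eta> x (inv_into (fibre A x) (\<tau> x) a) (inv_into (fibre A x) (\<tau> x) b))"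
    if U: "(U, \<tau>) \<in> trivs A" for U \<tau> a b
  proof (rule smooth_map_on_cong[OF M vector_bundleD(4)[OF V U]])
    show "smooth_map_on A U
        (\<lambda>x. c * \<omega> x (inv_into (fibre A x) (\<tau> x) a) (inv_into (fibre A x) (\<tau> x) b))"
      using \<omega> U unfolding two_form_def
      by (intro smooth_map_on_mult[OF M] smooth_map_on_const[OF M] vector_bundleD(4)[OF V U]) blast
  qed (simp add: \<eta> vector_bundleD(6)[OF V U])
  moreover have "linear_on_set (fibre A x) (\<eta> x v)" "linear_on_set (fibre A x) (\<lambda>u. \<eta> x u v)"
    "\<eta> x v v = 0" if v: "v \<in> fibre A x" for x v
    using two_formD[OF \<omega> v] lie_algebroidD(2)[of x] v
    by (auto simp: linear_on_set_def \<eta> subspace_add subspace_scale distrib_left)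
  ultimately show ?thesis by (auto simp: two_form_def)
qed

lemma Omega_N_structureI:
  assumes "two_form A \<omega>" "bundle_endo A N" "closed_form A \<omega>"
    and "\<And>X Y. X \<in> sections A \<Longrightarrow> Y \<in> sections A \<Longrightarrow> nijenhuis_torsion A N X Y = (\<lambda>x. 0)"
    and "endo_symmetric A \<omega> N" "closed_form A (form_endo \<omega> N)"
  shows "Omega_N_structure A \<omega> N"
  unfolding Omega_N_structure_def
proof (intro conjI assms allI ballI)
  fix x v assume "v \<in> fibre A x"
  then show "flat A \<omega> x (N x v) = transpose_endo A N x (flat A \<omega> x v)"
    using assms(5) bundle_endoD(1)[OF lie_algebroidD(1) assms(2)]
    by (auto simp: flat_def transpose_endo_def covec_def endo_symmetric_def fun_eq_iff)
qed

end

section \<open>Transition tensors\<close>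

lemma mod3_index: "(i::3) + 1 + 1 = i - 1" "(i::3) - 1 - 1 = i + 1"
  by (simp_all add: algebra_simps)

context
  fixes A :: "('m::{t2_space,second_countable_topology}, 'e::real_inner, 'v::real_vector,
               'k::real_inner, 'z) lie_algebroid_data_scheme"
    and \<epsilon> :: "3 \<Rightarrow> real"
    and \<omega> :: "3 \<Rightarrow> 'm \<Rightarrow> 'v \<Rightarrow> 'v \<Rightarrow> real"
    and \<pi> :: "3 \<Rightarrow> 'm \<Rightarrow> ('v \<Rightarrow> real) \<Rightarrow> ('v \<Rightarrow> real) \<Rightarrow> real"
  assumes A: "lie_algebroid A" and H: "hypersymplectic A \<epsilon> \<omega> \<pi>"
    and eps: "\<epsilon> 1 * \<epsilon> 2 * \<epsilon> 3 = 1"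
begin

private abbreviation (input) "N \<equiv> transition A \<omega> \<pi>"

section \<open>Pointwise algebra of the transition tensors\<close>

lemma hypersymplecticD:
  shows "two_form A (\<omega> i)" "closed_form A (\<omega> i)" "nondegenerate A (\<omega> i)"
    and "bivector A (\<pi> i)" "\<epsilon> i * \<epsilon> i = 1"
    and "\<alpha> \<in> dual_fibre A x \<Longrightarrow> flat A (\<omega> i) x (sharp A (\<pi> i) x \<alpha>) = \<alpha>"
    and transition_square: "v \<in> fibre A x \<Longrightarrow> N i x (N i x v) = \<epsilon> i *\<^sub>R v"
proof -
  have "\<epsilon> i = 1 \<or> \<epsilon> i = - 1" using H by (simp add: hypersymplectic_def)
  then show "\<epsilon> i * \<epsilon> i = 1" by auto
qed (use H in \<open>auto simp: hypersymplectic_def symplectic_form_def inverse_bivector_def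
  nondegenerate_def\<close>)

text \<open>The product of the three signs is 1 in every cyclic order; multiplying by
  \<open>\<epsilon> (i + 1)\<close>, whose square is 1, moves that sign to the other side.\<close>

lemma eps_mult: "\<epsilon> i * \<epsilon> (i - 1) = \<epsilon> (i + 1)"
proof -
  have "\<forall>i. \<epsilon> i * \<epsilon> (i - 1) * \<epsilon> (i + 1) = 1"
  proof -
    have "(1::3) - 1 = 3" "(1::3) + 1 = 2" "(2::3) - 1 = 1" "(2::3) + 1 = 3" "(3::3) - 1 = 2"
      "(3::3) + 1 = 1"
      by simp_all
    then show ?thesis unfolding forall_3 using eps by (simp only: mult_ac)
  qed
  then have "\<epsilon> i * \<epsilon> (i - 1) * (\<epsilon> (i + 1) * \<epsilon> (i + 1)) = \<epsilon> (i + 1)"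
    by (metis mult.assoc mult_1)
  then show ?thesis by (simp add: hypersymplecticD(5))
qed

lemma sharp_flat_spec:
  assumes "v \<in> fibre A x"
  shows "sharp A (\<pi> i) x (flat A (\<omega> j) x v) \<in> fibre A x"
    and "w \<in> fibre A x \<Longrightarrow> \<omega> i x (sharp A (\<pi> i) x (flat A (\<omega> j) x v)) w = \<omega> j x v w"
proof -
  note F = flat_dual[OF lie_algebroidD(1)[OF A] hypersymplecticD(1) assms, of j]
  show "sharp A (\<pi> i) x (flat A (\<omega> j) x v) \<in> fibre A x"
    by (rule sharp_spec(1)[OF lie_algebroidD(1)[OF A] hypersymplecticD(4) F])
  show "w \<in> fibre A x \<Longrightarrow> \<omega> i x (sharp A (\<pi> i) x (flat A (\<omega> j) x v)) w = \<omega> j x v w"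
    using fun_cong[OF hypersymplecticD(6)[OF F, of i], of w] by (simp add: flat_def covec_def)
qed

lemma transition_endo: "bundle_endo A (N i)"
  using bundle_endo_sharp_flat[OF lie_algebroidD(1)[OF A] hypersymplecticD(4) hypersymplecticD(1)]
  by (simp add: transition_def[abs_def])

lemmas transition_fibre = bundle_endoD(1)[OF lie_algebroidD(1)[OF A] transition_endo]
lemmas transition_linear = bundle_endoD(2)[OF lie_algebroidD(1)[OF A] transition_endo]
lemmas transition_scale = linear_on_set_scale[OF transition_linear]

text \<open>One relation in its three cyclic rotations, so that each form can be rewritten whatever
  its index looks like.\<close>

lemma form_transition:
  assumes "v \<in> fibre A x" "w \<in> fibre A x"
  shows "\<omega> (i - 1) x (N i x v) w = \<omega> (i + 1) x v w"
    and "\<omega> i x (N (i + 1) x v) w = \<omega> (i - 1) x v w"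
    and "\<omega> (i + 1) x (N (i - 1) x v) w = \<omega> i x v w"
proof -
  show *: "\<omega> (i - 1) x (N i x v) w = \<omega> (i + 1) x v w" for i
    using sharp_flat_spec(2)[OF assms] by (simp add: transition_def)
  show "\<omega> i x (N (i + 1) x v) w = \<omega> (i - 1) x v w"
    using *[of "i + 1"] by (simp add: mod3_index)
  show "\<omega> (i + 1) x (N (i - 1) x v) w = \<omega> i x v w"
    using *[of "i - 1"] by (simp add: mod3_index)
qed

lemma form_cancel:
  assumes "u \<in> fibre A x" "v \<in> fibre A x" "\<And>w. w \<in> fibre A x \<Longrightarrow> \<omega> i x u w = \<omega> i x v w"
  shows "u = v"
proof -
  note sub = lie_algebroidD(2)[OF A, of x]
  have "\<omega> i x (u - v) w = 0" if "w \<in> fibre A x" for w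
    using linear_on_set_diff[OF two_formD(2)[OF hypersymplecticD(1) that] sub assms(1,2)]
      assms(3)[OF that] by simp
  then have "u - v = 0"
    using hypersymplecticD(3)[of i] subspace_diff[OF sub assms(1,2)]
    unfolding nondegenerate_def by blast
  then show ?thesis by simp
qed

text \<open>Inside \<open>\<omega> (i - 1)\<close>, \<open>N i\<close> changes the form to
  \<open>\<omega> (i + 1)\<close>, \<open>N (i - 1)\<close> changes that to
  \<open>\<omega> i\<close>, and \<open>N (i + 1)\<close> leads back to
  \<open>\<omega> (i - 1)\<close>. Non-degeneracy concludes.\<close>

lemma transition_cycle:
  assumes "v \<in> fibre A x"
  shows "N i x (N (i - 1) x (N (i + 1) x v)) = v"
  by (rule form_cancel[of _ x _ "i - 1"])
     (simp_all add: assms transition_fibre form_transition)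

text \<open>The cycle relation and the squares give the factor
  \<open>\<epsilon> i * \<epsilon> (i - 1)\<close> for one order of composition and
  \<open>\<epsilon> (i + 1)\<close> for the other. \<open>eps_mult\<close> identifies the two, so
  the tensors commute; with the opposite sign they would anticommute.\<close>

lemma transition_comp:
  assumes v: "v \<in> fibre A x"
  shows "N (i - 1) x (N i x v) = \<epsilon> (i + 1) *\<^sub>R N (i + 1) x v"
    and "N i x (N (i - 1) x v) = \<epsilon> (i + 1) *\<^sub>R N (i + 1) x v"
proof -
  note f = transition_fibre v
  have "N i x v = N i x (N i x (N (i - 1) x (N (i + 1) x v)))"
    using transition_cycle[OF v] by simp
  also have "\<dots> = \<epsilon> i *\<^sub>R N (i - 1) x (N (i + 1) x v)"
    using transition_square f by simp
  finally have "N (i - 1) x (N i x v) = (\<epsilon> i * \<epsilon> (i - 1)) *\<^sub>R N (i + 1) x v"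
    using transition_square transition_scale f by simp
  then show "N (i - 1) x (N i x v) = \<epsilon> (i + 1) *\<^sub>R N (i + 1) x v" by (simp add: eps_mult)
  have "\<epsilon> (i + 1) *\<^sub>R N i x (N (i - 1) x v) = N (i + 1) x v"
    using transition_cycle[of "N (i + 1) x v" x i] transition_square transition_scale f by simp
  then have "(\<epsilon> (i + 1) * \<epsilon> (i + 1)) *\<^sub>R N i x (N (i - 1) x v) = \<epsilon> (i + 1) *\<^sub>R N (i + 1) x v"
    by (metis scaleR_scaleR)
  then show "N i x (N (i - 1) x v) = \<epsilon> (i + 1) *\<^sub>R N (i + 1) x v"
    by (simp add: hypersymplecticD(5))
qed

text \<open>For \<open>\<omega> (i - 1)\<close>: both it and its composite
  \<open>\<omega> (i + 1)\<close> with \<open>N i\<close> are skew. For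
  \<open>\<omega> (i + 1)\<close>: it is rewritten through \<open>\<omega> (i - 1)\<close>. For
  \<open>\<omega> i\<close>: it is rewritten as \<open>\<omega> (i + 1)\<close> composed with
  \<open>N (i - 1)\<close>, which commutes with \<open>N i\<close>.\<close>

lemma transition_symmetric:
  shows "endo_symmetric A (\<omega> (i - 1)) (N i)" "endo_symmetric A (\<omega> (i + 1)) (N i)"
    "endo_symmetric A (\<omega> i) (N i)"
proof -
  have 1: "\<omega> (i - 1) x (N i x v) w = \<omega> (i - 1) x v (N i x w)"
    if vw: "v \<in> fibre A x" "w \<in> fibre A x" for x v w
  proof -
    note skew = two_form_skew[OF hypersymplecticD(1) lie_algebroidD(2)[OF A]]
    have "\<omega> (i - 1) x (N i x v) w = - \<omega> (i + 1) x w v"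
      using form_transition(1)[OF vw] skew[OF vw] by simp
    also have "\<dots> = - \<omega> (i - 1) x (N i x w) v" using form_transition(1) vw by simp
    also have "\<dots> = \<omega> (i - 1) x v (N i x w)"
      using skew[OF vw(1) transition_fibre[OF vw(2)]] by simp
    finally show ?thesis .
  qed
  have 2: "\<omega> (i + 1) x (N i x v) w = \<omega> (i + 1) x v (N i x w)"
    if vw: "v \<in> fibre A x" "w \<in> fibre A x" for x v w
  proof -
    have "\<omega> (i + 1) x (N i x v) w = \<omega> (i - 1) x (N i x (N i x v)) w"
      using form_transition(1) transition_fibre vw by simp
    also have "\<dots> = \<omega> (i - 1) x (N i x v) (N i x w)" by (rule 1) (use vw transition_fibre in auto)
    also have "\<dots> = \<omega> (i + 1) x v (N i x w)" using form_transition(1) transition_fibre vw by simp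
    finally show ?thesis .
  qed
  have 3: "\<omega> i x (N i x v) w = \<omega> i x v (N i x w)"
    if vw: "v \<in> fibre A x" "w \<in> fibre A x" for x v w
  proof -
    have "\<omega> i x (N i x v) w = \<omega> (i + 1) x (N (i - 1) x (N i x v)) w"
      using form_transition(3) transition_fibre vw by simp
    also have "\<dots> = \<omega> (i + 1) x (N i x (N (i - 1) x v)) w" using transition_comp vw by simp
    also have "\<dots> = \<omega> (i + 1) x (N (i - 1) x v) (N i x w)"
      by (rule 2) (use vw transition_fibre in auto)
    also have "\<dots> = \<omega> i x v (N i x w)" using form_transition(3) transition_fibre vw by simp
    finally show ?thesis .
  qed
  show "endo_symmetric A (\<omega> (i - 1)) (N i)" "endo_symmetric A (\<omega> (i + 1)) (N i)"
    "endo_symmetric A (\<omega> i) (N i)"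
    using 1 2 3 by (auto simp: endo_symmetric_def)
qed

lemma form_scale: "v \<in> fibre A x \<Longrightarrow> w \<in> fibre A x \<Longrightarrow> \<omega> i x (c *\<^sub>R v) w = c * \<omega> i x v w"
  and form_scale_right: "v \<in> fibre A x \<Longrightarrow> w \<in> fibre A x \<Longrightarrow> \<omega> i x v (c *\<^sub>R w) = c * \<omega> i x v w"
  using linear_on_set_scale[OF two_formD(2)[OF hypersymplecticD(1)]]
    linear_on_set_scale[OF two_formD(1)[OF hypersymplecticD(1)]] by simp_all

section \<open>Vanishing torsions and closed composites for the transition tensors\<close>

lemma transition_torsion:
  assumes "X \<in> sections A" "Y \<in> sections A"
  shows "nijenhuis_torsion A (N i) X Y = (\<lambda>x. 0)"
\<comment> \<open>Relative to \<open>\<omega> (i - 1)\<close> the composites with \<open>N i\<close>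
  and with its square are \<open>\<omega> (i + 1)\<close> and \<open>\<epsilon> i\<close> times
  \<open>\<omega> (i - 1)\<close>, both closed.\<close>
proof (rule nijenhuis_torsion_0I[OF A, of "\<omega> (i - 1)"])
  show "closed_form A (form_endo (\<omega> (i - 1)) (N i))"
    by (rule closed_form_multiple[OF A hypersymplecticD(1,2)[of "i + 1"], of _ 1])
       (simp add: form_transition)
  show "closed_form A (form_endo (\<omega> (i - 1)) (\<lambda>x v. N i x (N i x v)))"
    by (rule closed_form_multiple[OF A hypersymplecticD(1,2)[of "i - 1"], of _ "\<epsilon> i"])
       (simp add: transition_square form_scale)
qed (intro hypersymplecticD transition_endo transition_symmetric assms)+

lemma transition_comp_torsion:
  assumes "X \<in> sections A" "Y \<in> sections A"
  shows "nijenhuis_torsion A (\<lambda>x v. N (i - 1) x (N i x v)) X Y = (\<lambda>x. 0)"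
\<comment> \<open>On the fibres the product is \<open>\<epsilon> (i + 1)\<close> times
  \<open>N (i + 1)\<close>, for which \<open>\<omega> i\<close> plays the part of the form with the
  preceding index.\<close>
proof (rule nijenhuis_torsion_0I[OF A, of "\<omega> i"])
  let ?P = "\<lambda>x v. N (i - 1) x (N i x v)"
  show "bundle_endo A ?P"
    by (rule bundle_endo_comp[OF lie_algebroidD(1)[OF A] transition_endo transition_endo])
  have sym: "\<omega> i x (N (i + 1) x v) w = \<omega> i x v (N (i + 1) x w)"
    if "v \<in> fibre A x" "w \<in> fibre A x" for x v w
    using transition_symmetric(1)[of "i + 1"] that by (simp add: endo_symmetric_def)
  then show "endo_symmetric A (\<omega> i) ?P"
    by (auto simp: endo_symmetric_def transition_comp transition_fibre form_scale form_scale_right)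
  show "closed_form A (form_endo (\<omega> i) ?P)"
    by (rule closed_form_multiple[OF A hypersymplecticD(1,2)[of "i - 1"], of _ "\<epsilon> (i + 1)"])
       (simp add: transition_comp transition_fibre form_scale form_transition)
  show "closed_form A (form_endo (\<omega> i) (\<lambda>x v. ?P x (?P x v)))"
    by (rule closed_form_multiple[OF A hypersymplecticD(1,2)[of i], of _ "\<epsilon> (i + 1)"])
       (simp add: transition_comp transition_fibre transition_scale transition_square form_scale
          hypersymplecticD(5) lie_algebroidD(2)[OF A] subspace_scale flip: mult.assoc)
qed (intro hypersymplecticD assms)+

text \<open>Since \<open>\<omega> i\<close> is \<open>\<omega> (i + 1)\<close> composed with
  \<open>N (i - 1)\<close>, the form in question is \<open>\<omega> (i + 1)\<close> composed with a
  product of two commuting tensors. With \<open>N (i - 1)\<close> alone it is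
  \<open>\<omega> i\<close>, and with \<open>N i\<close> alone \<open>\<epsilon> i\<close> times
  \<open>\<omega> (i - 1)\<close>.\<close>

lemma closed_form_transition: "closed_form A (form_endo (\<omega> i) (N i))"
proof (rule closed_form_cong[OF A])
  show "closed_form A (form_endo (\<omega> (i + 1)) (\<lambda>x v. N (i - 1) x (N i x v)))"
  proof (rule closed_form_endo_comp[OF A, where \<omega> = "\<omega> (i + 1)" and N = "N (i - 1)" and M = "N i"])
    show "closed_form A (form_endo (\<omega> (i + 1)) (N (i - 1)))"
      by (rule closed_form_multiple[OF A hypersymplecticD(1,2)[of i], of _ 1])
         (simp add: form_transition)
    show "closed_form A (form_endo (\<omega> (i + 1)) (N i))"
    proof (rule closed_form_multiple[OF A hypersymplecticD(1,2)[of "i - 1"], of _ "\<epsilon> i"])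
      fix x v w assume vw: "v \<in> fibre A x" "w \<in> fibre A x"
      show "\<omega> (i + 1) x (N i x v) w = \<epsilon> i * \<omega> (i - 1) x v w"
        using form_transition(1)[OF transition_fibre[OF vw(1)] vw(2), of i i]
        by (simp add: transition_square form_scale vw)
    qed
    show "endo_symmetric A (\<omega> (i + 1)) (N (i - 1))"
      using transition_symmetric(1)[of "i - 1"] by (simp add: mod3_index)
    show "bundle_endo A (\<lambda>x v. N (i - 1) x (N i x v))"
      by (rule bundle_endo_comp[OF lie_algebroidD(1)[OF A] transition_endo transition_endo])
    show "v = 0" if v: "v \<in> fibre A x" and "N (i - 1) x (N i x v) = 0" for x v
    proof -
      have "\<epsilon> i *\<^sub>R \<epsilon> (i - 1) *\<^sub>R v = N i x (N (i - 1) x (N (i - 1) x (N i x v)))"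
        by (simp add: transition_square transition_fibre transition_scale v mult.commute)
      also have "\<dots> = 0"
        using that(2) linear_on_set_0[OF transition_linear lie_algebroidD(2)[OF A]] by simp
      finally show ?thesis using hypersymplecticD(5)[of i] hypersymplecticD(5)[of "i - 1"] by auto
    qed
  qed (simp_all add: hypersymplecticD transition_endo transition_symmetric transition_torsion
      transition_comp_torsion transition_comp)
qed (simp add: form_transition transition_fibre)

section \<open>The induced form \<open>g\<close>\<close>

lemma induced_tensor_eq:
  "\<exists>c. \<forall>x. \<forall>v\<in>fibre A x. \<forall>w\<in>fibre A x. induced_tensor A \<epsilon> \<omega> \<pi> x v w = c * \<omega> i x (N i x v) w"
proof -
  let ?g = "induced_tensor A \<epsilon> \<omega> \<pi>"
  have g3: "?g x v w = \<epsilon> 2 * \<omega> 3 x (N 3 x v) w"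
    if vw: "v \<in> fibre A x" "w \<in> fibre A x" for x v w
  proof -
    \<comment> \<open>\<open>N 3\<close> is built from \<open>\<pi> 2\<close> and
      \<open>\<omega> 1\<close>, so this is the image of \<open>v\<close> under the inverse of
      \<open>N 3\<close>, which is \<open>\<epsilon> 3\<close> times \<open>N 3\<close>.\<close>
    let ?u = "sharp A (\<pi> 1) x (flat A (\<omega> 2) x v)"
    note u = sharp_flat_spec[OF vw(1), where i = 1 and j = 2]
    have "N 3 x ?u = v"
      by (rule form_cancel[of _ x _ 2])
         (use form_transition(2)[OF u(1), of _ 2] u vw transition_fibre in auto)
    then have "\<epsilon> 3 *\<^sub>R ?u = N 3 x v"
      using transition_square[OF u(1), of 3] by simp
    then have "\<omega> 3 x (N 3 x v) w = \<epsilon> 3 * \<omega> 3 x ?u w"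
      using form_scale[OF u(1) vw(2), of 3 "\<epsilon> 3"] by simp
    then show ?thesis
      using vw by (simp add: induced_tensor_def induced_flat_def flat_def covec_def)
  qed
  \<comment> \<open>Rewriting \<open>\<omega> i\<close> through \<open>\<omega> (i + 1)\<close>
    produces \<open>N (i - 1)\<close> after \<open>N i\<close>, a multiple of
    \<open>N (i + 1)\<close>. Thus the three composites agree up to constant signs.\<close>
  have step: "\<omega> i x (N i x v) w = \<epsilon> (i + 1) * \<omega> (i + 1) x (N (i + 1) x v) w"
    if vw: "v \<in> fibre A x" "w \<in> fibre A x" for x v w i
    using form_transition(3)[OF transition_fibre[OF vw(1)] vw(2), of i i] vw
    by (simp add: transition_comp form_scale transition_fibre)
  have step': "\<omega> (i + 1) x (N (i + 1) x v) w = \<epsilon> (i + 1) * \<omega> i x (N i x v) w"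
    if vw: "v \<in> fibre A x" "w \<in> fibre A x" for x v w i
    using step[OF vw, of i] hypersymplecticD(5)[of "i + 1"] by (simp flip: mult.assoc)
  have g2: "?g x v w = (\<epsilon> 2 * \<epsilon> 3) * \<omega> 2 x (N 2 x v) w"
    if "v \<in> fibre A x" "w \<in> fibre A x" for x v w
    using g3[OF that] step'[OF that, of 2] by simp
  have g1: "?g x v w = (\<epsilon> 2 * \<epsilon> 3 * \<epsilon> 2) * \<omega> 1 x (N 1 x v) w"
    if "v \<in> fibre A x" "w \<in> fibre A x" for x v w
    using g2[OF that] step'[OF that, of 1] by simp
  consider "i = 1" | "i = 2" | "i = 3" using exhaust_3 by blast
  then show ?thesis
  proof cases
    case 1
    show ?thesis unfolding 1 by (intro exI ballI allI) (rule g1)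
  next
    case 2
    show ?thesis unfolding 2 by (intro exI ballI allI) (rule g2)
  next
    case 3
    show ?thesis unfolding 3 by (intro exI ballI allI) (rule g3)
  qed
qed

lemma hypersymplectic_Omega_N:
  "Omega_N_structure A (\<omega> i) (N i)"
  by (intro Omega_N_structureI[OF A] hypersymplecticD transition_endo transition_torsion
      transition_symmetric closed_form_transition)

text \<open>Because \<open>g\<close> is a constant multiple of \<open>\<omega> i\<close> composed
  with \<open>N i\<close>, composing once more with \<open>N i\<close> gives a multiple of
  \<open>\<omega> i\<close> itself, which is closed.\<close>

lemma induced_tensor_Omega_N: "Omega_N_structure A (induced_tensor A \<epsilon> \<omega> \<pi>) (N i)"
proof -
  let ?g = "induced_tensor A \<epsilon> \<omega> \<pi>"
  obtain c where g: "\<And>x v w. v \<in> fibre A x \<Longrightarrow> w \<in> fibre A x \<Longrightarrow> ?g x v w = c * \<omega> i x (N i x v) w"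
    using induced_tensor_eq[of i] by blast
  have sym: "\<omega> i x (N i x v) w = \<omega> i x v (N i x w)" if "v \<in> fibre A x" "w \<in> fibre A x" for x v w
    using transition_symmetric(3) that by (simp add: endo_symmetric_def)
  have two: "two_form A (form_endo (\<omega> i) (N i))"
    by (rule two_form_endo[OF lie_algebroidD(1)[OF A] hypersymplecticD(1)[of i] transition_endo[of i]])
       (rule sym)
  show ?thesis
  proof (rule Omega_N_structureI[OF A])
    show "two_form A ?g" by (rule two_form_multiple[OF A two g])
    show "closed_form A ?g" by (rule closed_form_multiple[OF A two closed_form_transition g])
    show "endo_symmetric A ?g (N i)"
      by (simp add: endo_symmetric_def g transition_fibre sym)
    show "closed_form A (form_endo ?g (N i))"
      by (rule closed_form_multiple[OF A hypersymplecticD(1,2)[of i], of _ "c * \<epsilon> i"])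
         (simp add: g transition_fibre transition_square form_scale)
  qed (simp_all add: transition_endo transition_torsion)
qed

end

theorem corollary5p8:
  fixes A :: "('m::{t2_space,second_countable_topology}, 'e::real_inner, 'v::real_vector,
               'k::real_inner) lie_algebroid_data"
    and \<epsilon> :: "3 \<Rightarrow> real"
    and \<omega> :: "3 \<Rightarrow> 'm \<Rightarrow> 'v \<Rightarrow> 'v \<Rightarrow> real"
    and \<pi> :: "3 \<Rightarrow> 'm \<Rightarrow> ('v \<Rightarrow> real) \<Rightarrow> ('v \<Rightarrow> real) \<Rightarrow> real"
  assumes "lie_algebroid A"
    and "hypersymplectic A \<epsilon> \<omega> \<pi>"
    and "\<epsilon> 1 * \<epsilon> 2 * \<epsilon> 3 = 1"
  shows "\<forall>i. Omega_N_structure A (\<omega> i) (transition A \<omega> \<pi> i) \<and>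
             Omega_N_structure A (induced_tensor A \<epsilon> \<omega> \<pi>) (transition A \<omega> \<pi> i)"
  using hypersymplectic_Omega_N[OF assms] induced_tensor_Omega_N[OF assms] by blast

end
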